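(* Let $X$ be an infinite dimensional complex Banach space and let $T\in L(X)$. Then $$\partial\sigma_{\mathbf{R}_i}(T)\cap\operatorname{acc}\sigma_{\mathbf{R}_i}(T)\subset\sigma_{gK}(T),\qquad 1\le i\le 12.$$ Moreover, $$\partial\sigma_{\mathcal{B}_+}(T)\cap\operatorname{acc}\sigma_{ap}(T)\subset\sigma_{gK}(T),$$ $$\partial\sigma_{\mathcal{B}_-}(T)\cap\operatorname{acc}\sigma_{su}(T)\subset\sigma_{gK}(T),$$ $$\partial\sigma_{\mathcal{B}}(T)\cap\operatorname{acc}\sigma(T)\subset\sigma_{gK}(T).$$
   Context: For $K\subset\mathbb{C}$, $\partial K$ is the boundary and $\operatorname{acc}K$ the set of accumulation points of $K$. $L(Y)$ is the algebra of bounded linear operators on a Banach space $Y$; $T-\lambda$ means $T-\lambda I$. For $S\in L(Y)$, $N(S)$ and $R(S)$ are the kernel and range, $\alpha(S)=\dim N(S)$, $\beta(S)=\operatorname{codim}R(S)$, $\operatorname{asc}(S)=\inf\{n\ge0:N(S^n)=N(S^{n+1})\}$, $\operatorname{dsc}(S)=\inf\{n\ge0:R(S^n)=R(S^{n+1})\}$ ($\inf\emptyset=\infty$). Classes of operators on $X$: $\Phi_+(X)$: $R(S)$ closed and $\alpha(S)<\infty$; $\Phi_-(X)$: $\beta(S)<\infty$; $\Phi(X)$: $\alpha(S),\beta(S)<\infty$; for semi-Fredholm $S$, $\operatorname{ind}(S)=\alpha(S)-\beta(S)$; $\mathcal{W}_+(X)=\{S\in\Phi_+(X):\operatorname{ind}(S)\le0\}$;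 $\mathcal{W}_-(X)=\{S\in\Phi_-(X):\operatorname{ind}(S)\ge0\}$; $\mathcal{W}(X)=\{S\in\Phi(X):\operatorname{ind}(S)=0\}$; $\mathcal{B}_+(X)=\{S\in\Phi_+(X):\operatorname{asc}(S)<\infty\}$; $\mathcal{B}_-(X)=\{S\in\Phi_-(X):\operatorname{dsc}(S)<\infty\}$; $\mathcal{B}(X)=\mathcal{B}_+(X)\cap\mathcal{B}_-(X)$; $\mathcal{M}(X)$: bounded below operators ($c\|x\|\le\|Sx\|$ for some $c>0$ and all $x$); $\mathcal{Q}(X)$: surjective operators; $L(X)^{-1}$: invertible operators. $\mathbf{R}_1=\Phi_+(X)$, $\mathbf{R}_2=\Phi_-(X)$, $\mathbf{R}_3=\Phi(X)$, $\mathbf{R}_4=\mathcal{W}_+(X)$, $\mathbf{R}_5=\mathcal{W}_-(X)$, $\mathbf{R}_6=\mathcal{W}(X)$, $\mathbf{R}_7=\mathcal{B}_+(X)$, $\mathbf{R}_8=\mathcal{B}_-(X)$, $\mathbf{R}_9=\mathcal{B}(X)$, $\mathbf{R}_{10}=\mathcal{M}(X)$, $\mathbf{R}_{11}=\mathcal{Q}(X)$, $\mathbf{R}_{12}=L(X)^{-1}$. $\sigma_{\mathbf{R}_i}(T)=\{\lambda\in\mathbb{C}:T-\lambda\notin\mathbf{R}_i\}$; in particular $\sigma_{\mathcal{B}_+}=\sigma_{\mathbf{R}_7}$, $\sigma_{\mathcal{B}_-}=\sigma_{\mathbf{R}_8}$, $\sigma_{\mathcal{B}}=\sigma_{\mathbf{R}_9}$,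 $\sigma_{ap}=\sigma_{\mathbf{R}_{10}}$, $\sigma_{su}=\sigma_{\mathbf{R}_{11}}$, $\sigma=\sigma_{\mathbf{R}_{12}}$. $S\in L(Y)$ is Kato if $R(S)$ is closed and $N(S)\subset R(S^n)$ for all $n\ge 0$; quasinilpotent if $\|S^n\|^{1/n}\to0$. $S\in L(X)$ admits a generalized Kato decomposition (GKD) if there are closed $S$-invariant subspaces $M,N$ with $X=M\oplus N$ such that the restriction $S_M\in L(M)$ is Kato and the restriction $S_N\in L(N)$ is quasinilpotent (zero subspaces allowed). $\sigma_{gK}(T)=\{\lambda\in\mathbb{C}:T-\lambda\text{ does not admit a GKD}\}$. *)

theory Defs
  imports "HOL-Analysis.Analysis"
begin

section \<open>Complex Banach spaces\<close>

text \<open>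
  HOL-Analysis only has real normed spaces. The complex scalar multiplication below extends the
  real one, so that norm, topology and completeness are those of the underlying real space.
\<close>

class complex_normed_vector = real_normed_vector +
  fixes scaleC :: "complex \<Rightarrow> 'a \<Rightarrow> 'a" (infixr "*\<^sub>C" 75)
  assumes scaleC_add_right: "a *\<^sub>C (x + y) = a *\<^sub>C x + a *\<^sub>C y"
    and scaleC_add_left: "(a + b) *\<^sub>C x = a *\<^sub>C x + b *\<^sub>C x"
    and scaleC_scaleC: "a *\<^sub>C (b *\<^sub>C x) = (a * b) *\<^sub>C x"
    and scaleC_of_real: "complex_of_real r *\<^sub>C x = r *\<^sub>R x"
    and norm_scaleC: "norm (a *\<^sub>C x) = cmod a * norm x"

class complex_banach = complex_normed_vector + banach

global_interpretation cvec: vector_space "scaleC :: complex \<Rightarrow> 'a \<Rightarrow> 'a::complex_normed_vector"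
proof
  show "1 *\<^sub>C x = x" for x :: 'a
    using scaleC_of_real[of 1 x] by simp
qed (simp_all add: scaleC_add_right scaleC_add_left scaleC_scaleC)

interpretation cvec_pair: vector_space_pair
  "scaleC :: complex \<Rightarrow> 'a \<Rightarrow> 'a::complex_normed_vector"
  "scaleC :: complex \<Rightarrow> 'a \<Rightarrow> 'a::complex_normed_vector" ..

definition bounded_clinear :: "('a::complex_normed_vector \<Rightarrow> 'a) \<Rightarrow> bool" where
  "bounded_clinear S \<longleftrightarrow> bounded_linear S \<and> (\<forall>c x. S (c *\<^sub>C x) = c *\<^sub>C S x)"

section \<open>Dimension, codimension\<close>

text \<open>
  The library's dimension of an infinite dimensional space is \<open>0\<close>; this one is \<open>\<infinity>\<close>.
\<close>

definition ecdim :: "'a::complex_normed_vector set \<Rightarrow> enat" where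
  "ecdim V = (if \<exists>B. finite B \<and> V \<subseteq> cvec.span B then enat (cvec.dim V) else \<infinity>)"

definition direct_decomp :: "'a::complex_normed_vector set \<Rightarrow> 'a set \<Rightarrow> bool" where
  "direct_decomp M N \<longleftrightarrow> cvec.subspace M \<and> cvec.subspace N \<and> M \<inter> N = {0} \<and>
     (\<forall>x. \<exists>m\<in>M. \<exists>n\<in>N. x = m + n)"

text \<open>
  The codimension of a subspace is the dimension of an algebraic complement, i.e. of the
  quotient space; \<open>ex_complement\<close> and \<open>ecodim_eq\<close> show that it is well defined.
\<close>

definition ecodim :: "'a::complex_normed_vector set \<Rightarrow> enat" where
  "ecodim W = ecdim (SOME C. direct_decomp W C)"

lemma ex_complement:
  fixes W :: "'a::complex_normed_vector set"
  assumes W: "cvec.subspace W"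
  shows "\<exists>C. direct_decomp W C"
proof -
  have "Vector_Spaces.linear scaleC scaleC (\<lambda>x::'a. x)"
    by (rule cvec.linear_ident)
  from cvec_pair.linear_exists_left_inverse_on[OF this W]
  obtain g :: "'a \<Rightarrow> 'a" where g: "range g \<subseteq> W" "Vector_Spaces.linear scaleC scaleC g"
    "\<forall>v\<in>W. g v = v" by auto
  interpret g: Vector_Spaces.linear scaleC scaleC g by (rule g(2))
  have "cvec.subspace {x. g x = 0}"
    by (rule g.subspace_kernel)
  moreover have "\<exists>m\<in>W. \<exists>n\<in>{x. g x = 0}. x = m + n" for x
  proof (intro bexI)
    show "x = g x + (x - g x)" by simp
    show gx: "g x \<in> W" using g(1) by blast
    then have "g (g x) = g x" using g(3) by blast
    then show "x - g x \<in> {x. g x = 0}" by (simp add: g.diff)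
  qed
  moreover have "W \<inter> {x. g x = 0} = {0}"
    using g(3) W by (auto simp: cvec.subspace_0 g.zero)
  ultimately show ?thesis
    unfolding direct_decomp_def using W by blast
qed

lemma ecdim_complement_le:
  fixes W :: "'a::complex_normed_vector set"
  assumes C: "direct_decomp W C" and D: "direct_decomp W D"
  shows "ecdim D \<le> ecdim C"
proof (cases "\<exists>B. finite B \<and> C \<subseteq> cvec.span B")
  case True
  then obtain B0 where B0: "finite B0" "C \<subseteq> cvec.span B0" by blast
  obtain B where B: "B \<subseteq> C" "cvec.independent B" "C \<subseteq> cvec.span B" "card B = cvec.dim C"
    using cvec.basis_exists by blast
  have finB: "finite B"
    using cvec.independent_span_bound[OF B0(1) B(2)] B(1) B0(2) by blast
  have W: "cvec.subspace W" and sD: "cvec.subspace D"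
    using D by (auto simp: direct_decomp_def)
  have "\<forall>b. \<exists>d\<in>D. b - d \<in> W"
    using D unfolding direct_decomp_def by (metis add_diff_cancel_right')
  then obtain p where p: "\<And>b. p b \<in> D" "\<And>b. b - p b \<in> W" by metis
  have ex: "\<exists>e\<in>cvec.span (p ` B). c - e \<in> W" if "c \<in> cvec.span B" for c
    using that
  proof (induction rule: cvec.span_induct_alt)
    case base
    then show ?case using W cvec.subspace_0 cvec.span_zero by force
  next
    case (step k x y)
    then obtain e where e: "e \<in> cvec.span (p ` B)" "y - e \<in> W" by blast
    have "k *\<^sub>C p x + e \<in> cvec.span (p ` B)"
      using step e by (simp add: cvec.span_add cvec.span_scale cvec.span_base)
    moreover have "(k *\<^sub>C x + y) - (k *\<^sub>C p x + e) = k *\<^sub>C (x - p x) + (y - e)"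
      by (simp add: cvec.scale_right_diff_distrib)
    ultimately show ?case
      by (metis W e(2) p(2) cvec.subspace_add cvec.subspace_scale)
  qed
  have sub: "D \<subseteq> cvec.span (p ` B)"
  proof
    fix d assume d: "d \<in> D"
    obtain w c where wc: "w \<in> W" "c \<in> C" "d = w + c"
      using C unfolding direct_decomp_def by metis
    then obtain e where e: "e \<in> cvec.span (p ` B)" "c - e \<in> W" using ex B by blast
    have "cvec.span (p ` B) \<subseteq> D"
      using p(1) sD by (intro cvec.span_minimal) auto
    then have "d - e \<in> D" using d e sD by (auto intro: cvec.subspace_diff)
    moreover have "d - e \<in> W"
      using cvec.subspace_add[OF W wc(1) e(2)] wc(3) by (simp add: algebra_simps)
    ultimately have "d - e \<in> W \<inter> D" by blast
    then have "d - e = 0" using D unfolding direct_decomp_def by blast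
    then show "d \<in> cvec.span (p ` B)" using e by simp
  qed
  have "cvec.dim D \<le> card (p ` B)" using sub finB by (intro cvec.dim_le_card) auto
  also have "\<dots> \<le> cvec.dim C" using card_image_le[OF finB, of p] B by simp
  finally show ?thesis using True sub finB by (auto simp: ecdim_def)
qed (auto simp: ecdim_def)

lemma ecodim_eq: "direct_decomp W C \<Longrightarrow> ecodim W = ecdim C"
  unfolding ecodim_def by (metis ecdim_complement_le order_antisym someI)

section \<open>Classes of operators\<close>

definition ker :: "('a::complex_normed_vector \<Rightarrow> 'a) \<Rightarrow> 'a set" where
  "ker S = {x. S x = 0}"

definition alpha :: "('a::complex_normed_vector \<Rightarrow> 'a) \<Rightarrow> enat" where
  "alpha S = ecdim (ker S)"

definition beta :: "('a::complex_normed_vector \<Rightarrow> 'a) \<Rightarrow> enat" where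
  "beta S = ecodim (range S)"

text \<open>Only meaningful if \<open>alpha S\<close> or \<open>beta S\<close> is finite.\<close>

definition ind :: "('a::complex_normed_vector \<Rightarrow> 'a) \<Rightarrow> ereal" where
  "ind S = ereal_of_enat (alpha S) - ereal_of_enat (beta S)"

text \<open>In \<^typ>\<open>enat\<close> the infimum of the empty set is \<open>\<infinity>\<close>.\<close>

definition asc :: "('a::complex_normed_vector \<Rightarrow> 'a) \<Rightarrow> enat" where
  "asc S = Inf {enat n | n. ker (S ^^ n) = ker (S ^^ Suc n)}"

definition dsc :: "('a::complex_normed_vector \<Rightarrow> 'a) \<Rightarrow> enat" where
  "dsc S = Inf {enat n | n. range (S ^^ n) = range (S ^^ Suc n)}"

definition Phi_plus :: "('a::complex_normed_vector \<Rightarrow> 'a) set" where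
  "Phi_plus = {S. bounded_clinear S \<and> closed (range S) \<and> alpha S < \<infinity>}"

definition Phi_minus :: "('a::complex_normed_vector \<Rightarrow> 'a) set" where
  "Phi_minus = {S. bounded_clinear S \<and> beta S < \<infinity>}"

definition Phi :: "('a::complex_normed_vector \<Rightarrow> 'a) set" where
  "Phi = {S. bounded_clinear S \<and> alpha S < \<infinity> \<and> beta S < \<infinity>}"

definition W_plus :: "('a::complex_normed_vector \<Rightarrow> 'a) set" where
  "W_plus = {S \<in> Phi_plus. ind S \<le> 0}"

definition W_minus :: "('a::complex_normed_vector \<Rightarrow> 'a) set" where
  "W_minus = {S \<in> Phi_minus. ind S \<ge> 0}"

definition W_zero :: "('a::complex_normed_vector \<Rightarrow> 'a) set" where
  "W_zero = {S \<in> Phi. ind S = 0}"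

definition B_plus :: "('a::complex_normed_vector \<Rightarrow> 'a) set" where
  "B_plus = {S \<in> Phi_plus. asc S < \<infinity>}"

definition B_minus :: "('a::complex_normed_vector \<Rightarrow> 'a) set" where
  "B_minus = {S \<in> Phi_minus. dsc S < \<infinity>}"

definition B_both :: "('a::complex_normed_vector \<Rightarrow> 'a) set" where
  "B_both = B_plus \<inter> B_minus"

definition bounded_below_ops :: "('a::complex_normed_vector \<Rightarrow> 'a) set" where
  "bounded_below_ops = {S. bounded_clinear S \<and> (\<exists>c>0. \<forall>x. c * norm x \<le> norm (S x))}"

definition surjective_ops :: "('a::complex_normed_vector \<Rightarrow> 'a) set" where
  "surjective_ops = {S. bounded_clinear S \<and> surj S}"

definition invertible_ops :: "('a::complex_normed_vector \<Rightarrow> 'a) set" where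
  "invertible_ops = {S. bounded_clinear S \<and>
     (\<exists>S'. bounded_clinear S' \<and> S \<circ> S' = id \<and> S' \<circ> S = id)}"

text \<open>The family $\mathbf{R}_1, \dots, \mathbf{R}_{12}$; list indices start at \<open>0\<close>.\<close>

definition R_class :: "nat \<Rightarrow> ('a::complex_normed_vector \<Rightarrow> 'a) set" where
  "R_class i = [Phi_plus, Phi_minus, Phi, W_plus, W_minus, W_zero, B_plus, B_minus, B_both,
     bounded_below_ops, surjective_ops, invertible_ops] ! (i - 1)"

definition shift :: "('a::complex_normed_vector \<Rightarrow> 'a) \<Rightarrow> complex \<Rightarrow> 'a \<Rightarrow> 'a" where
  "shift T z = (\<lambda>x. T x - z *\<^sub>C x)"

definition spec :: "('a::complex_normed_vector \<Rightarrow> 'a) set \<Rightarrow> ('a \<Rightarrow> 'a) \<Rightarrow> complex set" where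
  "spec R T = {z. shift T z \<notin> R}"

definition acc :: "complex set \<Rightarrow> complex set" where
  "acc K = {z. z islimpt K}"

section \<open>Generalized Kato decomposition\<close>

text \<open>
  In the next two definitions \<open>M\<close> is meant to be a closed \<open>S\<close>-invariant subspace, and the notions
  are those of the restriction of \<open>S\<close> to the Banach space \<open>M\<close>. Since \<open>M\<close> is closed, closedness
  of the range relative to \<open>M\<close> and in the whole space agree.
\<close>

definition kato_on :: "'a::complex_normed_vector set \<Rightarrow> ('a \<Rightarrow> 'a) \<Rightarrow> bool" where
  "kato_on M S \<longleftrightarrow> closed (S ` M) \<and> (\<forall>n. {x \<in> M. S x = 0} \<subseteq> (S ^^ n) ` M)"

definition onorm_on :: "'a::complex_normed_vector set \<Rightarrow> ('a \<Rightarrow> 'a) \<Rightarrow> real" where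
  "onorm_on M S = (SUP x\<in>{x \<in> M. norm x \<le> 1}. norm (S x))"

definition quasinilpotent_on :: "'a::complex_normed_vector set \<Rightarrow> ('a \<Rightarrow> 'a) \<Rightarrow> bool" where
  "quasinilpotent_on M S \<longleftrightarrow> (\<lambda>n. root n (onorm_on M (S ^^ n))) \<longlonglongrightarrow> 0"

definition admits_GKD :: "('a::complex_normed_vector \<Rightarrow> 'a) \<Rightarrow> bool" where
  "admits_GKD S \<longleftrightarrow> (\<exists>M N. direct_decomp M N \<and> closed M \<and> closed N \<and>
     S ` M \<subseteq> M \<and> S ` N \<subseteq> N \<and> kato_on M S \<and> quasinilpotent_on N S)"

definition spec_gK :: "('a::complex_normed_vector \<Rightarrow> 'a) \<Rightarrow> complex set" where
  "spec_gK T = {z. \<not> admits_GKD (shift T z)}"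

end

theory Submission
  imports Defs
begin

text \<open>
  If \<open>S = T - z\<close> has a generalized Kato decomposition \<open>X = M \<oplus> N\<close>, then for small \<open>l \<noteq> 0\<close> the part of
  \<open>S - l\<close> on \<open>N\<close> is bijective, while on \<open>M\<close> the nullity and the defect of \<open>S - l\<close> do not depend on
  \<open>l\<close>, including \<open>l = 0\<close>, and the ranges stay closed. Hence membership of \<open>S - l\<close> in any of the
  classes is constant on a punctured disc, and it holds there as soon as it holds at some point of
  the whole disc. A boundary point of the spectrum that is also an accumulation point would need
  both members and non-members of the class in every such disc.

  The constancy on \<open>M\<close> comes from equations \<open>(S - l) x = y\<close> being solvable, whenever they are
  solvable at all, with \<open>norm x \<le> L * norm y\<close> for a constant \<open>L\<close> independent of \<open>l\<close>: kernels and
  ranges for nearby \<open>l\<close> are then close in the gap sense.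
\<close>

text \<open>At the centre \<open>l = 0\<close> the quasinilpotent part can have nonzero nullity and
  defect, so the index conditions reach the punctured disc only if these two numbers balance: a
  closed range gives defect <= nullity, and a finite defect gives equality. The Browder classes need
  a different argument. On \<open>M\<close> the kernel lies in a subspace \<open>Y\<close> that the
  operator maps onto itself; there finite ascent excludes nonzero kernel vectors, and finite descent
  forces surjectivity on \<open>M\<close>. Browder membership at one point thus gives operators that
  are even bounded below, or surjective, on the punctured disc, and this yields the three mixed
  inclusions. Nullities and defects may be infinite, so they are compared one finite level
  \<open>k\<close> at a time. The admissible step length shrinks as \<open>k\<close> grows, and
  connectedness of the disc carries each level across it.\<close>

section \<open>Open mapping and perturbation\<close>

text \<open>A quantitative form of openness. For a nonzero operator \<open>f\<close> with
  \<open>D\<close> the whole space and \<open>V\<close> its range, the infimum of the admissible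
  \<open>C\<close> is the reciprocal of the reduced minimum modulus of \<open>f\<close>. A larger
  \<open>V\<close> encodes surjectivity onto \<open>V\<close> as well.\<close>

definition lifting :: "real \<Rightarrow> ('b::real_normed_vector \<Rightarrow> 'c::real_normed_vector) \<Rightarrow> 'b set \<Rightarrow> 'c set \<Rightarrow> bool" where
  "lifting C f D V \<longleftrightarrow> (\<forall>y\<in>V. \<exists>x\<in>D. f x = y \<and> norm x \<le> C * norm y)"

text \<open>Successive approximation: the residuals halve at each step, so the corrections are
  dominated by a geometric series with sum \<open>2 * K * norm y\<close>. Keeping the residual in
  \<open>V\<close> is what allows the step to be iterated; completeness enters only through the
  domain.\<close>

lemma lifting_if_approx:
  fixes f :: "'b::banach \<Rightarrow> 'c::real_normed_vector"
  assumes f: "bounded_linear f" and D: "closed D" "subspace D"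
    and approx: "\<And>y. y \<in> V \<Longrightarrow> \<exists>x\<in>D. norm x \<le> K * norm y \<and> norm (y - f x) \<le> norm y / 2 \<and> y - f x \<in> V"
  shows "lifting (2 * K) f D V"
  unfolding lifting_def
proof
  fix y assume y: "y \<in> V"
  interpret f: bounded_linear f by fact
  obtain g where g: "\<And>y. y \<in> V \<Longrightarrow> g y \<in> D \<and> norm (g y) \<le> K * norm y \<and> norm (y - f (g y)) \<le> norm y / 2 \<and> y - f (g y) \<in> V"
    using approx by metis
  define r where "r = (\<lambda>n. ((\<lambda>u. u - f (g u)) ^^ n) y)"
  have r0: "r 0 = y" and rS: "\<And>n. r (Suc n) = r n - f (g (r n))"
    by (simp_all add: r_def)
  have rV: "r n \<in> V" for n
    by (induction n) (auto simp: r0 rS y g)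
  have rb: "norm (r n) \<le> norm y * (1/2) ^ n" for n
  proof (induction n)
    case (Suc n)
    have "norm (r (Suc n)) \<le> norm (r n) / 2" using g[OF rV[of n]] by (simp add: rS)
    with Suc show ?case by simp
  qed (simp add: r0)
  have K: "0 \<le> K * norm y"
    using g[OF y] norm_ge_zero order_trans by blast
  \<comment> \<open>The sign of \<open>K\<close> is not fixed in advance; a negative
    \<open>K\<close> forces every \<open>g (r n)\<close> to vanish.\<close>
  have gb: "norm (g (r n)) \<le> K * norm y * (1/2) ^ n" for n
  proof (cases "K \<ge> 0")
    case True
    have "norm (g (r n)) \<le> K * norm (r n)" using g[OF rV] by blast
    also have "\<dots> \<le> K * (norm y * (1/2) ^ n)" using True rb by (intro mult_left_mono)
    finally show ?thesis by simp
  next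
    case False
    then have "K * norm (r n) \<le> 0"
      by (simp add: mult_nonpos_nonneg)
    then have "norm (g (r n)) \<le> 0" using g[OF rV[of n]] by linarith
    then show ?thesis using K by (metis mult_nonneg_nonneg norm_le_zero_iff norm_zero zero_le_divide_1_iff zero_le_numeral zero_le_power)
  qed
  have geo: "(\<lambda>n. K * norm y * (1/2) ^ n) sums (K * norm y * 2)"
    using sums_mult[OF geometric_sums[of "1/2 :: real"], of "K * norm y"] by simp
  have sm: "summable (\<lambda>n. norm (g (r n)))"
    by (rule summable_comparison_test'[of "\<lambda>n. K * norm y * (1/2) ^ n" 0])
      (use geo gb in \<open>auto simp: sums_iff\<close>)
  define x where "x = (\<Sum>n. g (r n))"
  have xs: "(\<lambda>n. g (r n)) sums x"
    using sm by (simp add: x_def summable_norm_cancel summable_sums)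
  have "(\<lambda>n. r n - r (Suc n)) sums (r 0 - 0)"
  proof (rule telescope_sums')
    have "(\<lambda>n. norm y * (1/2) ^ n) \<longlonglongrightarrow> 0"
      by (intro tendsto_mult_right_zero LIMSEQ_power_zero) auto
    then show "r \<longlonglongrightarrow> 0"
      by (rule Lim_null_comparison[rotated]) (simp add: rb)
  qed
  moreover have "(\<lambda>n. r n - r (Suc n)) sums f x"
    using f.sums[OF xs] by (simp add: rS)
  ultimately have "f x = y" using sums_unique2 r0 by fastforce
  moreover have "x \<in> D"
  proof (rule closed_sequentially[OF D(1) _ xs[unfolded sums_def]])
    show "(\<Sum>i<n. g (r i)) \<in> D" for n
      by (intro subspace_sum D) (use g rV in auto)
  qed
  moreover have "norm x \<le> 2 * K * norm y"
  proof -
    have "norm x \<le> (\<Sum>n. norm (g (r n)))" unfolding x_def by (rule summable_norm[OF sm])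
    also have "\<dots> \<le> (\<Sum>n. K * norm y * (1/2) ^ n)"
      by (rule suminf_le[OF gb sm]) (use geo in \<open>simp add: sums_iff\<close>)
    also have "\<dots> = 2 * K * norm y" using geo by (simp add: sums_iff)
    finally show ?thesis .
  qed
  ultimately show "\<exists>x\<in>D. f x = y \<and> norm x \<le> 2 * K * norm y" by blast
qed

text \<open>A solution of \<open>f x = y\<close> misses \<open>y\<close> by exactly
  \<open>h x\<close> under the perturbed map, and the smallness condition makes this at most half of
  \<open>norm y\<close>. The doubled constant is the sum of the resulting geometric series.\<close>

lemma lifting_perturb:
  fixes f h :: "'b::banach \<Rightarrow> 'c::real_normed_vector"
  assumes f: "bounded_linear f" and h: "bounded_linear h" and D: "closed D" "subspace D"
    and V: "subspace V" and lift: "lifting C f D V" and hV: "h ` D \<subseteq> V"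
    and small: "\<And>x. x \<in> D \<Longrightarrow> 2 * C * norm (h x) \<le> norm x" and C: "C > 0"
  shows "lifting (2 * C) (\<lambda>x. f x + h x) D V"
proof (rule lifting_if_approx[OF bounded_linear_add[OF f h] D])
  fix y assume y: "y \<in> V"
  then obtain x where x: "x \<in> D" "f x = y" "norm x \<le> C * norm y"
    using lift unfolding lifting_def by blast
  have "2 * C * norm (h x) \<le> C * norm y" using small[OF x(1)] x(3) by linarith
  then have "norm (h x) \<le> norm y / 2" using C by simp
  moreover have "- h x \<in> V" using hV x(1) V by (auto intro: subspace_neg)
  ultimately show "\<exists>x\<in>D. norm x \<le> C * norm y \<and> norm (y - (f x + h x)) \<le> norm y / 2 \<and> y - (f x + h x) \<in> V"
    using x by (intro bexI[of _ x]) auto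
qed

text \<open>A point \<open>y\<close> of the closure is approximated by an image point within
  \<open>norm y / 2\<close>, which is lifted with norm at most \<open>2 * C * norm y\<close>; the
  residual stays in the closure. Iteration therefore solves \<open>f x = y\<close> for every
  \<open>y\<close> in the closure.\<close>

lemma closed_image_if_lifting:
  fixes f :: "'b::banach \<Rightarrow> 'c::real_normed_vector"
  assumes f: "bounded_linear f" and D: "closed D" "subspace D"
    and lift: "lifting C f D (f ` D)" and C: "C \<ge> 0"
  shows "closed (f ` D)"
proof -
  interpret f: bounded_linear f by fact
  have sV: "subspace (f ` D)"
    using linear_subspace_image[OF f.linear] D by blast
  have "lifting (2 * (2 * C)) f D (closure (f ` D))"
  proof (rule lifting_if_approx[OF f D])
    fix y assume y: "y \<in> closure (f ` D)"
    obtain y' where y': "y' \<in> f ` D" "norm (y - y') \<le> norm y / 2"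
    proof (cases "y = 0")
      case True
      then show ?thesis using that[of 0] sV by (simp add: subspace_0)
    next
      case False
      then obtain y' where "y' \<in> f ` D" "dist y' y < norm y / 2"
        using y unfolding closure_approachable by (metis half_gt_zero zero_less_norm_iff)
      then show ?thesis using that[of y'] by (simp add: dist_norm norm_minus_commute)
    qed
    obtain x where x: "x \<in> D" "f x = y'" "norm x \<le> C * norm y'"
      using lift y'(1) unfolding lifting_def by blast
    have "norm y' \<le> norm y + norm (y - y')"
      by (metis norm_minus_commute norm_triangle_sub)
    then have "norm y' \<le> 2 * norm y" using y'(2) norm_ge_zero[of y] by linarith
    then have "C * norm y' \<le> C * (2 * norm y)" using C by (rule mult_left_mono)
    moreover have "y - y' \<in> closure (f ` D)"
      unfolding closure_approachable
    proof (intro allI impI)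
      fix e :: real assume "e > 0"
      then obtain z where z: "z \<in> f ` D" "dist z y < e"
        using y unfolding closure_approachable by blast
      then show "\<exists>z\<in>f ` D. dist z (y - y') < e"
        using subspace_diff[OF sV z(1) y'(1)] by (intro bexI[of _ "z - y'"]) (auto simp: dist_norm)
    qed
    ultimately show "\<exists>x\<in>D. norm x \<le> 2 * C * norm y \<and> norm (y - f x) \<le> norm y / 2 \<and> y - f x \<in> closure (f ` D)"
      using x y' by (intro bexI[of _ x]) auto
  qed
  then have "closure (f ` D) \<subseteq> f ` D" unfolding lifting_def by force
  then show ?thesis by (simp add: closure_subset_eq)
qed

text \<open>Banach's open mapping theorem for the restriction to \<open>D\<close>. The closed image
  is completely metrizable, so by Baire the closure of the image of some ball has interior relative
  to it.\<close>

lemma open_mapping_lifting: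
  fixes f :: "'b::banach \<Rightarrow> 'c::banach"
  assumes f: "bounded_linear f" and D: "closed D" "subspace D" and V: "closed (f ` D)"
  obtains C where "C > 0" "lifting C f D (f ` D)"
proof -
  interpret f: bounded_linear f by fact
  let ?V = "f ` D"
  define G where "G n = closure (f ` (D \<inter> cball 0 (real n)))" for n
  have sV: "subspace ?V"
    using linear_subspace_image[OF f.linear] D by blast
  have GV: "G n \<subseteq> ?V" for n
    unfolding G_def by (rule closure_minimal) (use V in auto)
  have un: "\<Union>(range G) = ?V"
  proof
    show "?V \<subseteq> \<Union>(range G)"
    proof
      fix y assume "y \<in> ?V"
      then obtain x where "x \<in> D" "y = f x" by blast
      moreover obtain n where "norm x \<le> real n" using real_arch_simple by blast
      ultimately have "y \<in> G n" unfolding G_def using closure_subset by force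
      then show "y \<in> \<Union>(range G)" by blast
    qed
  qed (use GV in blast)
  have "\<exists>n. (top_of_set ?V) interior_of (G n) \<noteq> {}"
  proof (rule ccontr)
    assume no: "\<not> ?thesis"
    have cm: "completely_metrizable_space (top_of_set ?V)"
      using V completely_metrizable_space_closedin completely_metrizable_space_euclidean
      by (metis closed_closedin)
    have "(top_of_set ?V) interior_of \<Union>(range G) = {}"
    proof (intro Baire_category_alt[OF disjI1[OF cm]])
      fix T assume "T \<in> range G"
      then show "closedin (top_of_set ?V) T \<and> (top_of_set ?V) interior_of T = {}"
        using GV no by (auto simp: G_def intro!: closed_subset)
    qed auto
    then have "?V = {}" unfolding un
      by (metis interior_of_topspace topspace_euclidean_subtopology)
    then show False using sV subspace_0 by blast
  qed
  then obtain n y0 where "y0 \<in> (top_of_set ?V) interior_of (G n)" by blast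
  then obtain T where T: "openin (top_of_set ?V) T" "y0 \<in> T" "T \<subseteq> G n"
    by (auto simp: interior_of_def)
  then obtain r where r: "r > 0" "ball y0 r \<inter> ?V \<subseteq> G n"
    unfolding openin_contains_ball by blast
  have y0: "y0 \<in> ?V" "y0 \<in> G n" using T GV by auto
  \<comment> \<open>Both \<open>y0\<close> and \<open>y0 + t *\<^sub>R y\<close> are approximated by
    images of vectors of norm at most \<open>n\<close>. The difference of these vectors, divided by
    \<open>t = r / (2 * norm y)\<close>, has norm at most \<open>4 * n / r * norm y\<close>; the
    added 1 keeps \<open>K\<close> positive when \<open>n = 0\<close>.\<close>
  define K where "K = 4 * (real n + 1) / r"
  have K: "K > 0" using r by (simp add: K_def)
  have "lifting (2 * K) f D ?V"
  proof (rule lifting_if_approx[OF f D])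
    fix y assume y: "y \<in> ?V"
    show "\<exists>x\<in>D. norm x \<le> K * norm y \<and> norm (y - f x) \<le> norm y / 2 \<and> y - f x \<in> ?V"
    proof (cases "y = 0")
      case True
      then show ?thesis using D(2) sV by (intro bexI[of _ 0]) (auto simp: subspace_0 f.zero)
    next
      case False
      define t where "t = r / (2 * norm y)"
      have t: "t > 0" using r False by (simp add: t_def)
      have "norm (t *\<^sub>R y) < r" using r False by (simp add: t_def)
      then have "y0 + t *\<^sub>R y \<in> G n"
        using r(2) y y0 sV by (intro subsetD[OF r(2)]) (simp add: dist_norm subspace_add subspace_scale)
      \<comment> \<open>Two errors below \<open>e\<close>, divided by \<open>t\<close>, add up to at
        most \<open>norm y / 2\<close>.\<close>
      moreover define e where "e = t * norm y / 4"
      have e: "e > 0" using t False by (simp add: e_def)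
      ultimately obtain a b where ab: "a \<in> D" "norm a \<le> real n" "dist (f a) (y0 + t *\<^sub>R y) < e"
        "b \<in> D" "norm b \<le> real n" "dist (f b) y0 < e"
        using y0(2) unfolding G_def closure_approachable by force
      let ?x = "(1 / t) *\<^sub>R (a - b)"
      have "norm (a - b) \<le> 2 * (real n + 1)"
        using ab(2,5) norm_triangle_ineq4[of a b] by (simp add: algebra_simps)
      then have "norm ?x \<le> (1 / t) * (2 * (real n + 1))"
        using t by (simp add: divide_right_mono)
      also have "\<dots> = K * norm y" using r False by (simp add: t_def K_def)
      finally have 1: "norm ?x \<le> K * norm y" .
      have "t *\<^sub>R y - f (a - b) = (f b - y0) - (f a - (y0 + t *\<^sub>R y))"
        by (simp add: f.diff)
      then have "norm (t *\<^sub>R y - f (a - b)) \<le> norm (f b - y0) + norm (f a - (y0 + t *\<^sub>R y))"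
        by (metis norm_triangle_ineq4)
      also have "\<dots> \<le> e + e"
        using ab(3,6) by (intro add_mono) (auto simp: dist_norm)
      finally have "norm (t *\<^sub>R y - f (a - b)) \<le> 2 * e" by simp
      moreover have "y - f ?x = (1 / t) *\<^sub>R (t *\<^sub>R y - f (a - b))"
        using t by (simp add: f.diff f.scaleR scaleR_diff_right)
      ultimately have "norm (y - f ?x) \<le> (1 / t) * (2 * e)"
        using t by (simp add: divide_right_mono)
      also have "\<dots> = norm y / 2" using t by (simp add: e_def)
      finally have 2: "norm (y - f ?x) \<le> norm y / 2" .
      have x: "?x \<in> D" using D(2) ab by (simp add: subspace_diff subspace_scale)
      then have "y - f ?x \<in> ?V" using sV y by (auto intro: subspace_diff)
      with 1 2 x show ?thesis by blast
    qed
  qed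
  with K show ?thesis by (intro that[of "2 * K"]) auto
qed

section \<open>Relative codimension\<close>

text \<open>
  The dimension of \<open>V / (V \<inter> W)\<close>; it is at least \<open>k\<close> iff \<open>V\<close> contains \<open>k\<close> vectors that are linearly
  independent modulo \<open>W\<close>. Taking \<open>W = {0}\<close> gives the dimension of \<open>V\<close>, so nullities and defects
  are treated alike.
\<close>

definition rcodim_ge :: "nat \<Rightarrow> 'a::complex_normed_vector set \<Rightarrow> 'a set \<Rightarrow> bool" where
  "rcodim_ge k W V \<longleftrightarrow> (\<exists>e::nat \<Rightarrow> 'a. (\<forall>i<k. e i \<in> V) \<and>
     (\<forall>c. (\<Sum>i<k. c i *\<^sub>C e i) \<in> W \<longrightarrow> (\<forall>i<k. c i = 0)))"

definition rcodim :: "'a::complex_normed_vector set \<Rightarrow> 'a set \<Rightarrow> enat" where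
  "rcodim W V = Sup (enat ` {k. rcodim_ge k W V})"

lemma rcodim_ge_0 [simp]: "rcodim_ge 0 W V"
  by (simp add: rcodim_ge_def)

lemma rcodim_ge_le:
  assumes "rcodim_ge k W V" "j \<le> k"
  shows "rcodim_ge j W V"
proof -
  obtain e where e: "\<And>i. i < k \<Longrightarrow> e i \<in> V"
    "\<And>c. (\<Sum>i<k. c i *\<^sub>C e i) \<in> W \<Longrightarrow> \<forall>i<k. c i = 0"
    using assms unfolding rcodim_ge_def by blast
  have "\<forall>i<j. c i = 0" if "(\<Sum>i<j. c i *\<^sub>C e i) \<in> W" for c
  proof -
    let ?c = "\<lambda>i. if i < j then c i else 0"
    have "(\<Sum>i<k. ?c i *\<^sub>C e i) = (\<Sum>i<j. c i *\<^sub>C e i)"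
      using assms(2) by (intro sum.mono_neutral_cong_right) auto
    with that have "\<forall>i<k. ?c i = 0" using e(2)[of ?c] by simp
    then show ?thesis using assms(2) by (metis order_less_le_trans)
  qed
  then show ?thesis unfolding rcodim_ge_def using e(1) assms(2) by (intro exI[of _ e]) auto
qed

text \<open>Independent families can be shortened, so the supremum recovers every finite level.
  Equalities of possibly infinite dimensions can then be proved for one \<open>k\<close> at a
  time.\<close>

lemma enat_le_rcodim_iff: "enat k \<le> rcodim W V \<longleftrightarrow> rcodim_ge k W V"
proof
  assume k: "enat k \<le> rcodim W V"
  show "rcodim_ge k W V"
  proof (cases k)
    case (Suc j)
    then have "enat j < rcodim W V" using k by (metis Suc_ile_eq)
    then obtain i where "rcodim_ge i W V" "j < i"
      unfolding rcodim_def less_Sup_iff by auto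
    then show ?thesis using Suc rcodim_ge_le by (metis Suc_leI)
  qed simp
next
  assume "rcodim_ge k W V"
  then show "enat k \<le> rcodim W V"
    unfolding rcodim_def by (intro Sup_upper) auto
qed

lemma enat_leI:
  assumes "\<And>k. enat k \<le> x \<Longrightarrow> enat k \<le> y"
  shows "x \<le> y"
proof (cases x)
  case infinity
  then have "\<And>k. enat k \<le> y" using assms by simp
  then show ?thesis by (cases y) (auto, metis not_less_eq_eq order_refl)
qed (use assms in auto)

lemma enat_le_eqI:
  assumes "\<And>k. enat k \<le> x \<longleftrightarrow> enat k \<le> y"
  shows "x = y"
  using assms by (meson antisym enat_leI)

lemma rcodim_ge_cong:
  assumes "cvec.subspace V" "V \<subseteq> V'" "W' \<inter> V \<subseteq> W" "rcodim_ge k W V"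
  shows "rcodim_ge k W' V'"
proof -
  obtain e where e: "\<And>i. i < k \<Longrightarrow> e i \<in> V"
    "\<And>c. (\<Sum>i<k. c i *\<^sub>C e i) \<in> W \<Longrightarrow> \<forall>i<k. c i = 0"
    using assms(4) unfolding rcodim_ge_def by blast
  have "(\<Sum>i<k. c i *\<^sub>C e i) \<in> V" for c
    using e(1) assms(1) by (intro cvec.subspace_sum cvec.subspace_scale) auto
  then have "\<forall>i<k. c i = 0" if "(\<Sum>i<k. c i *\<^sub>C e i) \<in> W'" for c
    using that assms(3) e(2) by blast
  then show ?thesis unfolding rcodim_ge_def using e(1) assms(2) by blast
qed

text \<open>Independence modulo \<open>W\<close> is unaffected when each vector is replaced by
  another representative of its class.\<close>

lemma rcodim_ge_reduce:
  assumes W: "cvec.subspace W" and V: "\<And>v. v \<in> V \<Longrightarrow> \<exists>v'\<in>V'. v - v' \<in> W"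
    and ge: "rcodim_ge k W V"
  shows "rcodim_ge k W V'"
proof -
  obtain e where e: "\<And>i. i < k \<Longrightarrow> e i \<in> V"
    "\<And>c. (\<Sum>i<k. c i *\<^sub>C e i) \<in> W \<Longrightarrow> \<forall>i<k. c i = 0"
    using ge unfolding rcodim_ge_def by blast
  obtain p where p: "\<And>v. v \<in> V \<Longrightarrow> p v \<in> V'" "\<And>v. v \<in> V \<Longrightarrow> v - p v \<in> W"
    using V by metis
  have "\<forall>i<k. c i = 0" if "(\<Sum>i<k. c i *\<^sub>C p (e i)) \<in> W" for c
  proof (rule e(2))
    have "(\<Sum>i<k. c i *\<^sub>C (e i - p (e i))) \<in> W"
      using e(1) p(2) W by (intro cvec.subspace_sum cvec.subspace_scale) auto
    then have "(\<Sum>i<k. c i *\<^sub>C p (e i)) + (\<Sum>i<k. c i *\<^sub>C (e i - p (e i))) \<in> W"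
      using that W by (intro cvec.subspace_add)
    then show "(\<Sum>i<k. c i *\<^sub>C e i) \<in> W"
      by (simp add: cvec.scale_right_diff_distrib flip: sum.distrib)
  qed
  then show ?thesis unfolding rcodim_ge_def using e(1) p(1) by (intro exI[of _ "p \<circ> e"]) auto
qed

text \<open>After moving the family into \<open>cvec.span F\<close>, independence modulo
  \<open>W\<close> implies ordinary linear independence, and the Steinitz bound applies.\<close>

lemma rcodim_ge_le_card:
  assumes W: "cvec.subspace W" and F: "finite F"
    and V: "\<And>v. v \<in> V \<Longrightarrow> \<exists>s\<in>cvec.span F. v - s \<in> W" and ge: "rcodim_ge k W V"
  shows "k \<le> card F"
proof -
  obtain e where e: "\<And>i. i < k \<Longrightarrow> e i \<in> cvec.span F"
    "\<And>c. (\<Sum>i<k. c i *\<^sub>C e i) \<in> W \<Longrightarrow> \<forall>i<k. c i = 0"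
    using rcodim_ge_reduce[OF W V ge] unfolding rcodim_ge_def by blast
  have inj: "inj_on e {..<k}"
  proof (rule inj_onI, rule ccontr)
    fix i j assume ij: "i \<in> {..<k}" "j \<in> {..<k}" "e i = e j" "i \<noteq> j"
    let ?c = "\<lambda>l. if l = i then 1 else if l = j then -1 else (0::complex)"
    have "(\<Sum>l<k. ?c l *\<^sub>C e l) = (\<Sum>l\<in>{i,j}. ?c l *\<^sub>C e l)"
      using ij by (intro sum.mono_neutral_right) auto
    also have "\<dots> = 0" using ij by simp
    finally have "?c i = 0" using e(2)[of ?c] ij(1) W cvec.subspace_0 by force
    then show False by simp
  qed
  have "cvec.independent (e ` {..<k})"
  proof (rule cvec.independent_if_scalars_zero)
    fix f x assume f: "(\<Sum>x\<in>e ` {..<k}. f x *\<^sub>C x) = 0" and x: "x \<in> e ` {..<k}"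
    have "(\<Sum>i<k. f (e i) *\<^sub>C e i) = 0" using f by (simp add: sum.reindex[OF inj])
    then show "f x = 0" using e(2)[of "\<lambda>i. f (e i)"] x W cvec.subspace_0 by fastforce
  qed simp
  then have "card (e ` {..<k}) \<le> card F"
    using cvec.independent_span_bound[OF F] e(1) by blast
  then show ?thesis by (simp add: card_image[OF inj])
qed

lemma span_image_lessThan:
  assumes "s \<in> cvec.span (e ` {..<k::nat})"
  obtains c where "s = (\<Sum>i<k. c i *\<^sub>C e i)"
proof -
  let ?E = "range (\<lambda>c. \<Sum>i<k. c i *\<^sub>C e i)"
  have "cvec.subspace ?E"
  proof (rule cvec.subspaceI)
    show "0 \<in> ?E" by (rule image_eqI[of _ _ "\<lambda>_. 0"]) auto
    fix x y and d :: complex assume "x \<in> ?E"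
    then obtain c where c: "x = (\<Sum>i<k. c i *\<^sub>C e i)" by blast
    show "d *\<^sub>C x \<in> ?E"
      by (rule image_eqI[of _ _ "\<lambda>i. d * c i"]) (simp_all add: c cvec.scale_sum_right)
    assume "y \<in> ?E"
    then obtain c' where c': "y = (\<Sum>i<k. c' i *\<^sub>C e i)" by blast
    show "x + y \<in> ?E"
      by (rule image_eqI[of _ _ "\<lambda>i. c i + c' i"]) (simp_all add: c c' scaleC_add_left sum.distrib)
  qed
  moreover have "e ` {..<k} \<subseteq> ?E"
  proof
    fix x assume "x \<in> e ` {..<k}"
    then obtain j where j: "j < k" "x = e j" by blast
    have "(\<Sum>i<k. (if i = j then 1 else 0) *\<^sub>C e i) = (\<Sum>i\<in>{j}. (if i = j then 1 else 0) *\<^sub>C e i)"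
      using j by (intro sum.mono_neutral_right) auto
    also have "\<dots> = x" using j by simp
    finally show "x \<in> ?E" by (intro image_eqI[of _ _ "\<lambda>i. if i = j then 1 else 0"]) auto
  qed
  ultimately have "cvec.span (e ` {..<k}) \<subseteq> ?E" by (intro cvec.span_minimal)
  then show ?thesis using assms that by blast
qed

text \<open>Take a family of maximal length. Adjoining \<open>v\<close> produces a nontrivial
  relation modulo \<open>W\<close>, whose coefficient at \<open>v\<close> cannot vanish, so
  \<open>v\<close> can be solved for. The negated level \<open>Suc n\<close> is the finite way of
  saying that the relative codimension is at most \<open>n\<close>.\<close>

lemma finite_rcodim_span:
  assumes W: "cvec.subspace W" and V: "\<not> rcodim_ge (Suc n) W V"
  obtains F where "finite F" "F \<subseteq> V" "card F \<le> n" "W \<inter> cvec.span F \<subseteq> {0}"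
    "\<And>v. v \<in> V \<Longrightarrow> \<exists>s\<in>cvec.span F. v - s \<in> W"
proof -
  define m where "m = Max {k. rcodim_ge k W V}"
  have sub: "{k. rcodim_ge k W V} \<subseteq> {..n}"
    using V rcodim_ge_le[of _ W V "Suc n"] by (auto simp: not_less_eq_eq[symmetric])
  then have fin: "finite {k. rcodim_ge k W V}" using finite_subset by blast
  have m: "rcodim_ge m W V" "\<not> rcodim_ge (Suc m) W V" "m \<le> n"
  proof -
    have ne: "{k. rcodim_ge k W V} \<noteq> {}" using rcodim_ge_0 by blast
    show "rcodim_ge m W V" "m \<le> n" using Max_in[OF fin ne] sub unfolding m_def by auto
    show "\<not> rcodim_ge (Suc m) W V"
    proof
      assume "rcodim_ge (Suc m) W V"
      then show False using Max_ge[OF fin, of "Suc m"] unfolding m_def by simp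
    qed
  qed
  obtain e where e: "\<And>i. i < m \<Longrightarrow> e i \<in> V"
    "\<And>c. (\<Sum>i<m. c i *\<^sub>C e i) \<in> W \<Longrightarrow> \<forall>i<m. c i = 0"
    using m(1) unfolding rcodim_ge_def by blast
  show ?thesis
  proof
    show "finite (e ` {..<m})" "e ` {..<m} \<subseteq> V" "card (e ` {..<m}) \<le> n"
      using e(1) card_image_le[of "{..<m}" e] m(3) by auto
    show "W \<inter> cvec.span (e ` {..<m}) \<subseteq> {0}"
    proof
      fix s assume s: "s \<in> W \<inter> cvec.span (e ` {..<m})"
      then obtain c where "s = (\<Sum>i<m. c i *\<^sub>C e i)" using span_image_lessThan by blast
      then show "s \<in> {0}" using e(2)[of c] s by simp
    qed
    fix v assume v: "v \<in> V"
    let ?e = "e(m := v)"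
    have "\<forall>i<Suc m. ?e i \<in> V" using e(1) v by (auto simp: less_Suc_eq)
    then obtain c where c: "(\<Sum>i<Suc m. c i *\<^sub>C ?e i) \<in> W" "\<not> (\<forall>i<Suc m. c i = 0)"
      using m(2) unfolding rcodim_ge_def by blast
    have eq: "(\<Sum>i<Suc m. c i *\<^sub>C ?e i) = (\<Sum>i<m. c i *\<^sub>C e i) + c m *\<^sub>C v"
      by simp
    have cm: "c m \<noteq> 0"
    proof
      assume "c m = 0"
      then show False using c e(2)[of c] unfolding eq by (auto simp: less_Suc_eq)
    qed
    let ?s = "(- 1 / c m) *\<^sub>C (\<Sum>i<m. c i *\<^sub>C e i)"
    have "(1 / c m) *\<^sub>C (\<Sum>i<Suc m. c i *\<^sub>C ?e i) \<in> W"
      using c W by (intro cvec.subspace_scale)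
    moreover have "(1 / c m) *\<^sub>C (\<Sum>i<Suc m. c i *\<^sub>C ?e i) = v - ?s"
      using cm unfolding eq by (simp add: scaleC_add_right scaleC_scaleC flip: cvec.scale_minus_left)
    moreover have "?s \<in> cvec.span (e ` {..<m})"
      by (intro cvec.span_scale cvec.span_sum cvec.span_base) auto
    ultimately show "\<exists>s\<in>cvec.span (e ` {..<m}). v - s \<in> W" by metis
  qed
qed

lemma rcodim_eq_0_iff:
  assumes W: "cvec.subspace W"
  shows "rcodim W V = 0 \<longleftrightarrow> V \<subseteq> W"
proof -
  have "rcodim_ge 1 W V \<longleftrightarrow> \<not> V \<subseteq> W"
  proof
    assume "rcodim_ge 1 W V"
    then obtain e :: "nat \<Rightarrow> 'a" where e: "\<forall>i<1. e i \<in> V"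
      "\<forall>c. (\<Sum>i<1. c i *\<^sub>C e i) \<in> W \<longrightarrow> (\<forall>i<1. c i = 0)"
      unfolding rcodim_ge_def by blast
    show "\<not> V \<subseteq> W" using e(1) e(2)[rule_format, of "\<lambda>_. 1" 0] by auto
  next
    assume "\<not> V \<subseteq> W"
    then obtain v where v: "v \<in> V" "v \<notin> W" by blast
    have "c = 0" if "c *\<^sub>C v \<in> W" for c
    proof (rule ccontr)
      assume "c \<noteq> 0"
      then show False using cvec.subspace_scale[OF W that, of "1 / c"] v(2) by simp
    qed
    then show "rcodim_ge 1 W V"
      unfolding rcodim_ge_def using v(1) by (intro exI[of _ "\<lambda>_. v"]) auto
  qed
  then show ?thesis
    using enat_le_rcodim_iff[of 1 W V] by (metis ileI1 le_zero_eq not_one_le_zero one_enat_def one_eSuc zero_less_iff_neq_zero)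
qed

lemma rcodim_ge_card_independent:
  assumes B: "finite B" "B \<subseteq> V" "cvec.independent B"
  shows "rcodim_ge (card B) {0} V"
proof -
  obtain h where h: "bij_betw h {..<card B} B"
    using ex_bij_betw_nat_finite[OF B(1)] by (auto simp: atLeast0LessThan)
  have "\<forall>i<card B. c i = 0" if "(\<Sum>i<card B. c i *\<^sub>C h i) \<in> {0}" for c
  proof -
    let ?g = "the_inv_into {..<card B} h"
    have gh: "?g (h i) = i" if "i < card B" for i
      using that h by (simp add: the_inv_into_f_f bij_betw_def)
    have "(\<Sum>b\<in>B. c (?g b) *\<^sub>C b) = (\<Sum>i<card B. c (?g (h i)) *\<^sub>C h i)"
      by (rule sum.reindex_bij_betw[OF h, symmetric])
    also have "\<dots> = 0" using that gh by simp
    finally have "\<And>b. b \<in> B \<Longrightarrow> c (?g b) = 0"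
      using B cvec.independentD[of B B "\<lambda>b. c (?g b)"] by blast
    then show ?thesis using gh h by (metis bij_betwE lessThan_iff)
  qed
  moreover have "\<forall>i<card B. h i \<in> V"
    using h B(2) bij_betwE by fastforce
  ultimately show ?thesis unfolding rcodim_ge_def by blast
qed

text \<open>A basis settles the finite dimensional case. Otherwise no level can fail, because a
  failing level would produce a finite spanning set.\<close>

lemma ecdim_eq_rcodim: "cvec.subspace V \<Longrightarrow> ecdim V = rcodim {0} V"
proof (rule enat_le_eqI)
  fix k assume V: "cvec.subspace V"
  have s0: "cvec.subspace {0}" by (rule cvec.subspace_single_0)
  show "enat k \<le> ecdim V \<longleftrightarrow> enat k \<le> rcodim {0} V"
    unfolding enat_le_rcodim_iff
  proof (cases "\<exists>B. finite B \<and> V \<subseteq> cvec.span B")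
    case True
    then obtain B0 where B0: "finite B0" "V \<subseteq> cvec.span B0" by blast
    obtain B where B: "B \<subseteq> V" "cvec.independent B" "V \<subseteq> cvec.span B" "card B = cvec.dim V"
      using cvec.basis_exists by blast
    have finB: "finite B"
      using cvec.independent_span_bound[OF B0(1) B(2)] B(1) B0(2) by blast
    have "rcodim_ge (card B) {0} V" using rcodim_ge_card_independent finB B by blast
    moreover have "j \<le> card B" if "rcodim_ge j {0} V" for j
      by (rule rcodim_ge_le_card[OF s0 finB _ that]) (use B(3) in force)
    ultimately show "enat k \<le> ecdim V \<longleftrightarrow> rcodim_ge k {0} V"
      using True B(4) rcodim_ge_le by (auto simp: ecdim_def)
  next
    case False
    have "rcodim_ge k {0} V"
    proof (rule ccontr)
      assume "\<not> ?thesis"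
      then have "\<not> rcodim_ge (Suc k) {0} V" using rcodim_ge_le le_SucI by blast
      then obtain F where F: "finite F" "\<And>v. v \<in> V \<Longrightarrow> \<exists>s\<in>cvec.span F. v - s \<in> {0}"
        using finite_rcodim_span[OF s0] by metis
      have "V \<subseteq> cvec.span F"
      proof
        fix v assume "v \<in> V"
        then obtain s where "s \<in> cvec.span F" "v - s \<in> {0}" using F(2) by blast
        then show "v \<in> cvec.span F" by simp
      qed
      with F(1) False show False by blast
    qed
    moreover have "ecdim V = \<infinity>"
      unfolding ecdim_def by (rule if_not_P[OF False])
    ultimately show "enat k \<le> ecdim V \<longleftrightarrow> rcodim_ge k {0} V" by simp
  qed
qed

text \<open>An algebraic complement contains exactly one representative of each class modulo
  \<open>W\<close>, so families can be moved between it and the whole space.\<close>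

lemma ecodim_eq_rcodim:
  assumes W: "cvec.subspace W"
  shows "ecodim W = rcodim W UNIV"
proof -
  obtain C where C: "direct_decomp W C" using ex_complement[OF W] by blast
  then have sC: "cvec.subspace C" and int: "W \<inter> C = {0}" and
    dec: "\<And>x. \<exists>w\<in>W. \<exists>c\<in>C. x = w + c" by (auto simp: direct_decomp_def)
  have "rcodim_ge k {0} C \<longleftrightarrow> rcodim_ge k W UNIV" for k
  proof
    assume "rcodim_ge k {0} C"
    then show "rcodim_ge k W UNIV"
      using rcodim_ge_cong[OF sC, of UNIV W "{0}"] int by blast
  next
    assume "rcodim_ge k W UNIV"
    moreover have "\<exists>c\<in>C. x - c \<in> W" for x using dec[of x] by force
    ultimately have "rcodim_ge k W C" using rcodim_ge_reduce[OF W] by blast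
    then show "rcodim_ge k {0} C"
      by (rule rcodim_ge_cong[OF sC, rotated 2]) (use W cvec.subspace_0 in auto)
  qed
  then show ?thesis
    unfolding ecodim_eq[OF C] ecdim_eq_rcodim[OF sC]
    by (intro enat_le_eqI) (simp add: enat_le_rcodim_iff)
qed

section \<open>Additivity of relative codimension\<close>

lemma rcodim_ge_add:
  assumes V: "cvec.subspace V1" "cvec.subspace V2" "V1 \<subseteq> V" "V2 \<subseteq> V"
    and W: "\<And>x y. x \<in> V1 \<Longrightarrow> y \<in> V2 \<Longrightarrow> x + y \<in> W \<Longrightarrow> x \<in> W1 \<and> y \<in> W2"
    and ge: "rcodim_ge j W1 V1" "rcodim_ge k W2 V2"
  shows "rcodim_ge (j + k) W V"
proof -
  obtain e where e: "\<And>i. i < j \<Longrightarrow> e i \<in> V1"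
    "\<And>c. (\<Sum>i<j. c i *\<^sub>C e i) \<in> W1 \<Longrightarrow> \<forall>i<j. c i = 0"
    using ge(1) unfolding rcodim_ge_def by blast
  obtain f where f: "\<And>i. i < k \<Longrightarrow> f i \<in> V2"
    "\<And>c. (\<Sum>i<k. c i *\<^sub>C f i) \<in> W2 \<Longrightarrow> \<forall>i<k. c i = 0"
    using ge(2) unfolding rcodim_ge_def by blast
  let ?g = "\<lambda>i. if i < j then e i else f (i - j)"
  have "\<forall>i<j+k. c i = 0" if c: "(\<Sum>i<j+k. c i *\<^sub>C ?g i) \<in> W" for c
  proof -
    have "(\<Sum>i<j+k. c i *\<^sub>C ?g i) = (\<Sum>i<j. c i *\<^sub>C ?g i) + (\<Sum>i<k. c (j + i) *\<^sub>C ?g (j + i))"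
      by (induction k) (simp_all add: algebra_simps)
    also have "\<dots> = (\<Sum>i<j. c i *\<^sub>C e i) + (\<Sum>i<k. c (j + i) *\<^sub>C f i)"
      by simp
    finally have "(\<Sum>i<j. c i *\<^sub>C e i) + (\<Sum>i<k. c (j + i) *\<^sub>C f i) \<in> W"
      using c by simp
    moreover have "(\<Sum>i<j. c i *\<^sub>C e i) \<in> V1" "(\<Sum>i<k. c (j + i) *\<^sub>C f i) \<in> V2"
      using e(1) f(1) V by (auto intro!: cvec.subspace_sum cvec.subspace_scale)
    ultimately have z: "\<forall>i<j. c i = 0" "\<forall>i<k. c (j + i) = 0"
      using W e(2)[of c] f(2)[of "\<lambda>i. c (j + i)"] by blast+
    show ?thesis
    proof (intro allI impI)
      fix i assume "i < j + k"
      then show "c i = 0" using z(1) z(2)[rule_format, of "i - j"] by (cases "i < j") auto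
    qed
  qed
  then show ?thesis unfolding rcodim_ge_def using e f V by (intro exI[of _ ?g]) auto
qed

lemma not_rcodim_ge_add:
  assumes V: "\<And>v. v \<in> V \<Longrightarrow> \<exists>v1\<in>V1. \<exists>v2\<in>V2. v = v1 + v2"
    and W: "cvec.subspace W" "cvec.subspace W1" "cvec.subspace W2" "W1 \<subseteq> W" "W2 \<subseteq> W"
    and nge: "\<not> rcodim_ge (Suc j) W1 V1" "\<not> rcodim_ge (Suc k) W2 V2"
  shows "\<not> rcodim_ge (Suc (j + k)) W V"
proof
  assume ge: "rcodim_ge (Suc (j + k)) W V"
  obtain F where F: "finite F" "card F \<le> j" "\<And>v. v \<in> V1 \<Longrightarrow> \<exists>s\<in>cvec.span F. v - s \<in> W1"
    using finite_rcodim_span[OF W(2) nge(1)] by metis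
  obtain G where G: "finite G" "card G \<le> k" "\<And>v. v \<in> V2 \<Longrightarrow> \<exists>s\<in>cvec.span G. v - s \<in> W2"
    using finite_rcodim_span[OF W(3) nge(2)] by metis
  have "Suc (j + k) \<le> card (F \<union> G)"
  proof (rule rcodim_ge_le_card[OF W(1) _ _ ge])
    fix v assume "v \<in> V"
    then obtain v1 v2 where v: "v1 \<in> V1" "v2 \<in> V2" "v = v1 + v2" using V by blast
    then obtain s t where s: "s \<in> cvec.span F" "v1 - s \<in> W1" and t: "t \<in> cvec.span G" "v2 - t \<in> W2"
      using F G by blast
    have "s + t \<in> cvec.span (F \<union> G)"
      using s t cvec.span_mono[of F "F \<union> G"] cvec.span_mono[of G "F \<union> G"] by (intro cvec.span_add) auto
    moreover have "v - (s + t) \<in> W"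
      using cvec.subspace_add[OF W(1), of "v1 - s" "v2 - t"] s t v W by (auto simp: algebra_simps)
    ultimately show "\<exists>s\<in>cvec.span (F \<union> G). v - s \<in> W" by blast
  qed (use F G in auto)
  then show False using card_Un_le[of F G] F G by linarith
qed

text \<open>Concatenated families give the lower bound, united spanning sets the upper one. With
  zero spaces for \<open>W\<close>, \<open>W1\<close>, \<open>W2\<close> this splits nullities, and
  with ranges it splits defects.\<close>

lemma rcodim_add:
  assumes V: "cvec.subspace V1" "cvec.subspace V2" "V1 \<subseteq> V" "V2 \<subseteq> V"
    "\<And>v. v \<in> V \<Longrightarrow> \<exists>v1\<in>V1. \<exists>v2\<in>V2. v = v1 + v2"
    and W: "cvec.subspace W" "cvec.subspace W1" "cvec.subspace W2" "W1 \<subseteq> W" "W2 \<subseteq> W"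
    and split: "\<And>x y. x \<in> V1 \<Longrightarrow> y \<in> V2 \<Longrightarrow> x + y \<in> W \<Longrightarrow> x \<in> W1 \<and> y \<in> W2"
  shows "rcodim W V = rcodim W1 V1 + rcodim W2 V2"
proof (rule antisym)
  have le: "enat (j + k) \<le> rcodim W V" if "enat j \<le> rcodim W1 V1" "enat k \<le> rcodim W2 V2" for j k
    using rcodim_ge_add[OF V(1-4) split] that unfolding enat_le_rcodim_iff by blast
  show "rcodim W1 V1 + rcodim W2 V2 \<le> rcodim W V"
  proof (cases "rcodim W1 V1 = \<infinity> \<or> rcodim W2 V2 = \<infinity>")
    case True
    then have "enat n \<le> rcodim W V" for n
      using le[of n 0] le[of 0 n] by (auto simp: zero_enat_def[symmetric])
    then have "rcodim W V = \<infinity>"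
      by (cases "rcodim W V") (auto, metis not_less_eq_eq order_refl)
    then show ?thesis by simp
  next
    case False
    then obtain j k where "rcodim W1 V1 = enat j" "rcodim W2 V2 = enat k" by auto
    then show ?thesis using le[of j k] by simp
  qed
  show "rcodim W V \<le> rcodim W1 V1 + rcodim W2 V2"
  proof (cases "rcodim W1 V1 = \<infinity> \<or> rcodim W2 V2 = \<infinity>")
    case False
    then obtain j k where jk: "rcodim W1 V1 = enat j" "rcodim W2 V2 = enat k" by auto
    have "\<not> rcodim_ge (Suc j) W1 V1" "\<not> rcodim_ge (Suc k) W2 V2"
      using jk by (simp_all flip: enat_le_rcodim_iff)
    from not_rcodim_ge_add[OF V(5) W this] have "\<not> enat (Suc (j + k)) \<le> rcodim W V"
      by (simp add: enat_le_rcodim_iff)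
    then show ?thesis using jk by (cases "rcodim W V") auto
  qed auto
qed

section \<open>Riesz' lemma and stability of dimensions\<close>

lemma subspace_if_csubspace: "cvec.subspace V \<Longrightarrow> subspace V"
  unfolding subspace_def cvec.subspace_def by (metis scaleC_of_real)

lemma bounded_linear_scaleC_right: "bounded_linear (\<lambda>x. c *\<^sub>C x)"
proof (rule bounded_linear_intro[where K = "cmod c"])
  show "c *\<^sub>C (r *\<^sub>R x) = r *\<^sub>R (c *\<^sub>C x)" for r and x :: 'a
    by (simp add: mult.commute flip: scaleC_of_real)
qed (simp_all add: scaleC_add_right norm_scaleC)

lemma bounded_linear_scaleC_left: "bounded_linear (\<lambda>c. c *\<^sub>C x)"
proof (rule bounded_linear_intro[where K = "norm x"])
  show "(r *\<^sub>R c) *\<^sub>C x = r *\<^sub>R (c *\<^sub>C x)" for r c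
    by (simp add: scaleR_conv_of_real flip: scaleC_of_real)
qed (simp_all add: scaleC_add_left norm_scaleC)

section \<open>Closedness of sums with finite dimensional spaces\<close>

lemma csubspace_add_span:
  assumes "cvec.subspace W"
  shows "cvec.subspace {x. \<exists>s\<in>cvec.span F. x - s \<in> W}"
proof -
  have "{x. \<exists>s\<in>cvec.span F. x - s \<in> W} = {x + y |x y. x \<in> W \<and> y \<in> cvec.span F}"
    by (auto simp: Bex_def) (metis add_diff_cancel_right' diff_add_cancel)+
  then show ?thesis using cvec.subspace_sums[OF assms cvec.subspace_span] by simp
qed

text \<open>If \<open>e\<close> is outside \<open>W\<close>, its distance \<open>d\<close> from
  \<open>W\<close> is positive and controls the coefficient:
  \<open>cmod c <= norm (w + c *\<^sub>C e) / d\<close>. The sum map on \<open>W\<close> times the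
  complex line then lifts with a uniform bound, so its image is closed.\<close>

lemma closed_add_line:
  fixes W :: "'a::complex_banach set"
  assumes W: "closed W" "cvec.subspace W"
  shows "closed {x. \<exists>c. x - c *\<^sub>C e \<in> W}"
proof (cases "e \<in> W")
  case True
  have "{x. \<exists>c. x - c *\<^sub>C e \<in> W} = W"
  proof safe
    fix x c assume "x - c *\<^sub>C e \<in> W"
    then show "x \<in> W"
      using cvec.subspace_add[OF W(2) _ cvec.subspace_scale[OF W(2) True, of c]] by fastforce
  next
    fix x assume "x \<in> W"
    then show "\<exists>c. x - c *\<^sub>C e \<in> W" by (intro exI[of _ 0]) simp
  qed
  then show ?thesis using W by simp
next
  case False
  define d where "d = infdist e W"
  have d: "d > 0"
    unfolding d_def using infdist_pos_not_in_closed[OF W(1) _ False] cvec.subspace_0[OF W(2)] by blast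
  have le: "cmod c * d \<le> norm (w + c *\<^sub>C e)" if w: "w \<in> W" for w c
  proof (cases "c = 0")
    case c: False
    have "d \<le> dist e ((- 1 / c) *\<^sub>C w)"
      unfolding d_def by (intro infdist_le cvec.subspace_scale W w)
    then have "cmod c * d \<le> cmod c * norm (e - (- 1 / c) *\<^sub>C w)"
      by (simp add: dist_norm mult_left_mono)
    also have "\<dots> = norm (c *\<^sub>C (e - (- 1 / c) *\<^sub>C w))" by (simp add: norm_scaleC)
    also have "c *\<^sub>C (e - (- 1 / c) *\<^sub>C w) = w + c *\<^sub>C e"
      using c by (simp add: scaleC_add_right add.commute)
    finally show ?thesis .
  qed simp
  define f where "f = (\<lambda>p::'a \<times> complex. fst p + snd p *\<^sub>C e)"
  have f: "bounded_linear f" unfolding f_def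
    using bounded_linear_compose[OF bounded_linear_scaleC_left[of e] bounded_linear_snd]
    by (intro bounded_linear_add bounded_linear_fst)
  have "subspace (W \<times> (UNIV :: complex set))"
    using subspace_Times[OF subspace_if_csubspace[OF W(2)] subspace_UNIV] .
  \<comment> \<open>For \<open>y = w + c *\<^sub>C e\<close> the coefficient is at most
    \<open>norm y / d\<close> and \<open>norm w <= norm y + cmod c * norm e\<close>; the norm of the
    pair is bounded by the sum of the two.\<close>
  moreover have "lifting (1 + (norm e + 1) / d) f (W \<times> UNIV) (f ` (W \<times> UNIV))"
    unfolding lifting_def
  proof
    fix y assume "y \<in> f ` (W \<times> UNIV)"
    then obtain w c where w: "w \<in> W" "y = w + c *\<^sub>C e" unfolding f_def by fastforce
    have c: "cmod c \<le> norm y / d" using le[OF w(1), of c] w(2) d by (simp add: field_simps)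
    have "norm w \<le> norm y + cmod c * norm e"
      using norm_triangle_ineq4[of y "c *\<^sub>C e"] w(2) by (simp add: norm_scaleC)
    then have "norm (w, c) \<le> norm y + cmod c * norm e + cmod c"
      using norm_Pair_le[of w c] by linarith
    also have "\<dots> = norm y + cmod c * (norm e + 1)" by (simp add: algebra_simps)
    also have "\<dots> \<le> norm y + norm y / d * (norm e + 1)"
      using c by (intro add_left_mono mult_right_mono) auto
    also have "\<dots> = (1 + (norm e + 1) / d) * norm y" by (simp add: algebra_simps)
    finally show "\<exists>x\<in>W \<times> UNIV. f x = y \<and> norm x \<le> (1 + (norm e + 1) / d) * norm y"
      using w by (intro bexI[of _ "(w, c)"]) (auto simp: f_def)
  qed
  ultimately have "closed (f ` (W \<times> UNIV))"
    using d by (intro closed_image_if_lifting[OF f]) (auto intro: closed_Times W)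
  moreover have "f ` (W \<times> UNIV) = {x. \<exists>c. x - c *\<^sub>C e \<in> W}"
  proof safe
    fix w c assume "w \<in> W"
    then show "\<exists>d. f (w, c) - d *\<^sub>C e \<in> W" by (intro exI[of _ c]) (simp add: f_def)
  next
    fix x c assume "x - c *\<^sub>C e \<in> W"
    then show "x \<in> f ` (W \<times> UNIV)" by (intro image_eqI[of _ _ "(x - c *\<^sub>C e, c)"]) (auto simp: f_def)
  qed
  ultimately show ?thesis by simp
qed

lemma closed_add_span:
  fixes W :: "'a::complex_banach set"
  assumes W: "closed W" "cvec.subspace W" and F: "finite F"
  shows "closed {x. \<exists>s\<in>cvec.span F. x - s \<in> W}"
  using F
proof induction
  case empty
  then show ?case using W by simp
next
  case (insert e F)
  let ?U = "{x. \<exists>s\<in>cvec.span F. x - s \<in> W}"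
  have "{x. \<exists>s\<in>cvec.span (insert e F). x - s \<in> W} = {x. \<exists>c. x - c *\<^sub>C e \<in> ?U}"
  proof (intro set_eqI iffI)
    fix x assume "x \<in> {x. \<exists>s\<in>cvec.span (insert e F). x - s \<in> W}"
    then obtain s where s: "s \<in> cvec.span (insert e F)" "x - s \<in> W" by blast
    then obtain c where "s - c *\<^sub>C e \<in> cvec.span F" by (auto simp: cvec.span_insert)
    then have "x - c *\<^sub>C e \<in> ?U"
      using s(2) by (intro CollectI bexI[of _ "s - c *\<^sub>C e"]) auto
    then show "x \<in> {x. \<exists>c. x - c *\<^sub>C e \<in> ?U}" by blast
  next
    fix x assume "x \<in> {x. \<exists>c. x - c *\<^sub>C e \<in> ?U}"
    then obtain c s where s: "s \<in> cvec.span F" "x - c *\<^sub>C e - s \<in> W" by blast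
    then have "s + c *\<^sub>C e \<in> cvec.span (insert e F)"
      unfolding cvec.span_insert by (auto intro!: exI[of _ c])
    then show "x \<in> {x. \<exists>s\<in>cvec.span (insert e F). x - s \<in> W}"
      using s(2) by (intro CollectI bexI[of _ "s + c *\<^sub>C e"]) (auto simp: algebra_simps)
  qed
  then show ?case
    using closed_add_line[OF insert.IH csubspace_add_span[OF W(2)]] by simp
qed

section \<open>Riesz families and subspaces with a small gap\<close>

lemma riesz_lemma:
  assumes W: "closed W" "cvec.subspace W" and V: "cvec.subspace V" "W \<subseteq> V" "\<not> V \<subseteq> W"
  obtains u where "u \<in> V" "norm u = 1" "\<And>w. w \<in> W \<Longrightarrow> 1 / 2 \<le> norm (u - w)"
proof -
  obtain v where v: "v \<in> V" "v \<notin> W" using V by blast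
  have ne: "W \<noteq> {}" using cvec.subspace_0[OF W(2)] by blast
  have d: "infdist v W > 0" using infdist_pos_not_in_closed[OF W(1) ne v(2)] .
  \<comment> \<open>A nearest point of \<open>W\<close> need not exist; a minimiser up to the factor
    2 does, and this factor is the origin of the bound 1/2.\<close>
  have "\<exists>w\<in>W. dist v w < 2 * infdist v W"
  proof (rule ccontr)
    assume "\<not> ?thesis"
    then have "2 * infdist v W \<le> infdist v W"
      unfolding infdist_notempty[OF ne] by (intro cINF_greatest ne) (auto simp: not_less)
    then show False using d by simp
  qed
  then obtain w0 where w0: "w0 \<in> W" "norm (v - w0) < 2 * infdist v W"
    by (auto simp: dist_norm)
  define t where "t = norm (v - w0)"
  have t: "t > 0" using v w0 by (auto simp: t_def)
  show ?thesis
  proof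
    show "(1 / t) *\<^sub>R (v - w0) \<in> V"
      using subspace_if_csubspace[OF V(1)] v w0 V(2) by (intro subspace_scale subspace_diff) auto
    show "norm ((1 / t) *\<^sub>R (v - w0)) = 1" using t by (simp add: t_def)
    fix w assume w: "w \<in> W"
    have "w0 + t *\<^sub>R w \<in> W"
      using subspace_if_csubspace[OF W(2)] w w0 by (intro subspace_add subspace_scale)
    then have "infdist v W \<le> norm (v - (w0 + t *\<^sub>R w))"
      using infdist_le[of _ W v] by (simp add: dist_norm)
    then have "t / 2 \<le> norm (v - (w0 + t *\<^sub>R w))" using w0(2) by (simp add: t_def)
    also have "v - (w0 + t *\<^sub>R w) = t *\<^sub>R ((1 / t) *\<^sub>R (v - w0) - w)"
      using t by (simp add: scaleR_diff_right)
    also have "norm \<dots> = t * norm ((1 / t) *\<^sub>R (v - w0) - w)" using t by simp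
    finally have "t * (1 / 2) \<le> t * norm ((1 / t) *\<^sub>R (v - w0) - w)" by simp
    then show "1 / 2 \<le> norm ((1 / t) *\<^sub>R (v - w0) - w)"
      using t by (rule mult_left_le_imp_le)
  qed
qed

text \<open>
  The constant \<open>5 ^ k\<close> depends on \<open>k\<close> only. This makes the radii in the stability results below
  uniform, so that no comparison of infinite (co)dimensions is needed.
\<close>

lemma riesz_family:
  fixes W :: "'a::complex_banach set"
  assumes W: "closed W" "cvec.subspace W" and V: "cvec.subspace V" "W \<subseteq> V"
    and ge: "rcodim_ge k W V"
  shows "\<exists>e. (\<forall>i<k. e i \<in> V \<and> norm (e i) = 1) \<and>
    (\<forall>c. \<forall>w\<in>W. (\<Sum>i<k. cmod (c i)) \<le> 5 ^ k * norm (w + (\<Sum>i<k. c i *\<^sub>C e i)))"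
  using ge
proof (induction k)
  case (Suc k)
  then obtain e where e: "\<And>i. i < k \<Longrightarrow> e i \<in> V \<and> norm (e i) = 1"
    "\<And>c w. w \<in> W \<Longrightarrow> (\<Sum>i<k. cmod (c i)) \<le> 5 ^ k * norm (w + (\<Sum>i<k. c i *\<^sub>C e i))"
    using rcodim_ge_le le_SucI order_refl by metis
  let ?F = "e ` {..<k}"
  let ?U = "{x. \<exists>s\<in>cvec.span ?F. x - s \<in> W}"
  \<comment> \<open>Modulo \<open>W\<close>, the space \<open>?U\<close> is spanned by
    \<open>k\<close> vectors, too few for level \<open>Suc k\<close>; hence there is room for one
    more Riesz vector.\<close>
  have "\<not> V \<subseteq> ?U"
  proof
    assume "V \<subseteq> ?U"
    then have "Suc k \<le> card ?F"
      by (intro rcodim_ge_le_card[OF W(2) _ _ Suc.prems]) auto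
    then show False using card_image_le[of "{..<k}" e] by simp
  qed
  moreover have "?U \<subseteq> V"
  proof safe
    fix x s assume s: "s \<in> cvec.span ?F" "x - s \<in> W"
    have "s \<in> V" using cvec.span_minimal[of ?F V] V(1) e(1) s(1) by blast
    then show "x \<in> V" using cvec.subspace_add[OF V(1), of "x - s" s] s(2) V(2) by auto
  qed
  ultimately obtain u where u: "u \<in> V" "norm u = 1" "\<And>w. w \<in> ?U \<Longrightarrow> 1 / 2 \<le> norm (u - w)"
    using riesz_lemma[of ?U V] closed_add_span[OF W, of ?F] csubspace_add_span[OF W(2), of ?F] V(1)
    by (metis (no_types, lifting) finite_imageI finite_lessThan)
  let ?e = "e(k := u)"
  have "(\<Sum>i<Suc k. cmod (c i)) \<le> 5 ^ Suc k * norm (w + (\<Sum>i<Suc k. c i *\<^sub>C ?e i))"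
    if w: "w \<in> W" for c w
  proof -
    define s where "s = w + (\<Sum>i<k. c i *\<^sub>C e i)"
    have eq: "w + (\<Sum>i<Suc k. c i *\<^sub>C ?e i) = s + c k *\<^sub>C u" by (simp add: s_def)
    have sU: "s \<in> ?U"
    proof -
      have "(\<Sum>i<k. c i *\<^sub>C e i) \<in> cvec.span ?F"
        by (intro cvec.span_sum cvec.span_scale cvec.span_base) auto
      then show ?thesis using w by (auto simp: s_def intro!: bexI[of _ "\<Sum>i<k. c i *\<^sub>C e i"])
    qed
    \<comment> \<open>Distance 1/2 of \<open>u\<close> from \<open>?U\<close> costs a factor 2 for
      the last coefficient, so \<open>norm s\<close> is at most 3 times the full norm. The base 5
      then comes from \<open>3 * 5 ^ k + 2 <= 5 ^ Suc k\<close>.\<close>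
    have ck: "cmod (c k) \<le> 2 * norm (s + c k *\<^sub>C u)"
    proof (cases "c k = 0")
      case False
      have "(- 1 / c k) *\<^sub>C s \<in> ?U"
        by (rule cvec.subspace_scale[OF csubspace_add_span[OF W(2)] sU])
      from u(3)[OF this] have "cmod (c k) * (1 / 2) \<le> cmod (c k) * norm (u - (- 1 / c k) *\<^sub>C s)"
        by (rule mult_left_mono) simp
      also have "\<dots> = norm (c k *\<^sub>C (u - (- 1 / c k) *\<^sub>C s))" by (simp add: norm_scaleC)
      also have "c k *\<^sub>C (u - (- 1 / c k) *\<^sub>C s) = s + c k *\<^sub>C u"
        using False by (simp add: scaleC_add_right add.commute)
      finally show ?thesis by simp
    qed simp
    have "norm s \<le> norm (s + c k *\<^sub>C u) + cmod (c k)"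
      using norm_triangle_ineq4[of "s + c k *\<^sub>C u" "c k *\<^sub>C u"] u(2) by (simp add: norm_scaleC)
    then have "norm s \<le> 3 * norm (s + c k *\<^sub>C u)" using ck by linarith
    then have "(5::real) ^ k * norm s \<le> 5 ^ k * (3 * norm (s + c k *\<^sub>C u))"
      by (intro mult_left_mono) auto
    then have "(\<Sum>i<k. cmod (c i)) \<le> 5 ^ k * (3 * norm (s + c k *\<^sub>C u))"
      using e(2)[OF w, of c] unfolding s_def[symmetric] by linarith
    moreover have "1 * norm (s + c k *\<^sub>C u) \<le> 5 ^ k * norm (s + c k *\<^sub>C u)"
      by (intro mult_right_mono) auto
    ultimately show ?thesis unfolding eq using ck by simp
  qed
  moreover have "\<forall>i<Suc k. ?e i \<in> V \<and> norm (?e i) = 1"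
    using e(1) u by (auto simp: less_Suc_eq)
  ultimately show ?case by blast
qed simp

text \<open>Replace a Riesz family in \<open>V\<close> by nearby vectors of \<open>U\<close>. A
  vanishing combination of these would have coefficient sum \<open>s\<close> with
  \<open>s <= 5 ^ k * d * s\<close>, hence \<open>s = 0\<close>. Only the one-sided gap from
  \<open>V\<close> to \<open>U\<close> enters.\<close>

lemma rcodim_ge_gap_subspace:
  fixes U V :: "'a::complex_banach set"
  assumes V: "cvec.subspace V" and gap: "\<And>v. v \<in> V \<Longrightarrow> \<exists>u\<in>U. norm (v - u) \<le> d * norm v"
    and d: "5 ^ k * d < 1" and ge: "rcodim_ge k {0} V"
  shows "rcodim_ge k {0} U"
proof -
  obtain e where e: "\<And>i. i < k \<Longrightarrow> e i \<in> V \<and> norm (e i) = 1"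
    "\<And>c. (\<Sum>i<k. cmod (c i)) \<le> 5 ^ k * norm (\<Sum>i<k. c i *\<^sub>C e i)"
    using riesz_family[OF _ cvec.subspace_single_0 V _ ge] cvec.subspace_0[OF V] by fastforce
  obtain p where p: "\<And>v. v \<in> V \<Longrightarrow> p v \<in> U" "\<And>v. v \<in> V \<Longrightarrow> norm (v - p v) \<le> d * norm v"
    using gap by metis
  have "\<forall>i<k. c i = 0" if c: "(\<Sum>i<k. c i *\<^sub>C p (e i)) \<in> {0}" for c
  proof -
    let ?S = "\<Sum>i<k. cmod (c i)"
    have "(\<Sum>i<k. c i *\<^sub>C e i) = (\<Sum>i<k. c i *\<^sub>C (e i - p (e i)))"
      using c by (simp add: cvec.scale_right_diff_distrib sum_subtractf)
    also have "norm \<dots> \<le> (\<Sum>i<k. cmod (c i) * d)"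
    proof (rule sum_norm_le)
      fix i assume "i \<in> {..<k}"
      then have "norm (e i - p (e i)) \<le> d" using e(1) p(2) by fastforce
      then show "norm (c i *\<^sub>C (e i - p (e i))) \<le> cmod (c i) * d"
        by (simp add: norm_scaleC mult_left_mono)
    qed
    also have "\<dots> = d * ?S" by (simp add: sum_distrib_left mult.commute)
    finally have "5 ^ k * norm (\<Sum>i<k. c i *\<^sub>C e i) \<le> 5 ^ k * (d * ?S)"
      by (intro mult_left_mono) auto
    with e(2)[of c] have "?S \<le> 5 ^ k * (d * ?S)" by (rule order_trans)
    then have "?S \<le> (5 ^ k * d) * ?S" by (simp only: mult.assoc)
    then have "?S \<le> 0"
      using d by (metis mult_le_cancel_right1 not_le)
    then show ?thesis by (metis (no_types, lifting) finite_lessThan lessThan_iff norm_ge_zero norm_le_zero_iff order_antisym sum_nonneg sum_nonneg_eq_0_iff)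
  qed
  then show ?thesis unfolding rcodim_ge_def using e(1) p(1) by (intro exI[of _ "p \<circ> e"]) auto
qed

text \<open>The dual statement: the family stays fixed and the subspace factored out moves. The gap
  is therefore needed in the direction from \<open>W'\<close> to \<open>W\<close>: a combination
  lying in \<open>W'\<close> is close to \<open>W\<close>, which the Riesz bound permits only for
  zero coefficients.\<close>

lemma rcodim_ge_gap_quotient:
  fixes W V :: "'a::complex_banach set"
  assumes W: "closed W" "cvec.subspace W" and V: "cvec.subspace V" "W \<subseteq> V"
    and gap: "\<And>v. v \<in> W' \<Longrightarrow> \<exists>u\<in>W. norm (v - u) \<le> d * norm v"
    and d: "5 ^ k * d < 1" "d \<ge> 0" and ge: "rcodim_ge k W V"
  shows "rcodim_ge k W' V"
proof -
  obtain e where e: "\<And>i. i < k \<Longrightarrow> e i \<in> V \<and> norm (e i) = 1"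
    "\<And>c w. w \<in> W \<Longrightarrow> (\<Sum>i<k. cmod (c i)) \<le> 5 ^ k * norm (w + (\<Sum>i<k. c i *\<^sub>C e i))"
    using riesz_family[OF W V ge] by blast
  have "\<forall>i<k. c i = 0" if c: "(\<Sum>i<k. c i *\<^sub>C e i) \<in> W'" for c
  proof -
    let ?S = "\<Sum>i<k. cmod (c i)" and ?v = "\<Sum>i<k. c i *\<^sub>C e i"
    obtain w where w: "w \<in> W" "norm (?v - w) \<le> d * norm ?v" using gap[OF c] by blast
    have "norm ?v \<le> ?S"
      by (rule sum_norm_le) (use e(1) in \<open>simp add: norm_scaleC\<close>)
    then have "norm (?v - w) \<le> d * ?S" using w(2) d(2) by (meson mult_left_mono order_trans)
    then have "5 ^ k * norm (- w + ?v) \<le> 5 ^ k * (d * ?S)" by (intro mult_left_mono) auto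
    moreover have "- w \<in> W" using w(1) W(2) by (rule cvec.subspace_neg[rotated])
    ultimately have "?S \<le> 5 ^ k * (d * ?S)" using e(2)[of "- w" c] by linarith
    then have "?S \<le> (5 ^ k * d) * ?S" by (simp only: mult.assoc)
    then have "?S \<le> 0"
      using d by (metis mult_le_cancel_right1 not_le)
    then show ?thesis by (metis (no_types, lifting) finite_lessThan lessThan_iff norm_ge_zero norm_le_zero_iff order_antisym sum_nonneg sum_nonneg_eq_0_iff)
  qed
  then show ?thesis unfolding rcodim_ge_def using e(1) by blast
qed

section \<open>Kato operators\<close>

lemma bounded_clinearD:
  assumes "bounded_clinear S"
  shows "bounded_linear S" "S (c *\<^sub>C x) = c *\<^sub>C S x" "S (x + y) = S x + S y" "S (x - y) = S x - S y"
    "S 0 = 0" "S (- x) = - S x"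
proof -
  show S: "bounded_linear S" and "S (c *\<^sub>C x) = c *\<^sub>C S x"
    using assms by (auto simp: bounded_clinear_def)
  interpret bounded_linear S by fact
  show "S (x + y) = S x + S y" "S (x - y) = S x - S y" "S 0 = 0" "S (- x) = - S x"
    by (simp_all add: add diff zero neg)
qed

lemma bounded_clinear_shift:
  assumes "bounded_clinear S"
  shows "bounded_clinear (shift S l)"
  unfolding bounded_clinear_def
proof (intro conjI allI)
  show "bounded_linear (shift S l)"
    unfolding shift_def using bounded_clinearD(1)[OF assms]
    by (intro bounded_linear_sub bounded_linear_scaleC_right)
  show "shift S l (c *\<^sub>C x) = c *\<^sub>C shift S l x" for c x
    by (simp add: shift_def bounded_clinearD(2)[OF assms] cvec.scale_right_diff_distrib scaleC_scaleC mult.commute)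
qed

lemma shift_0 [simp]: "shift S 0 = S"
  by (simp add: shift_def)

lemma shift_shift: "shift (shift T z) l = shift T (z + l)"
  by (auto simp: shift_def scaleC_add_left)

lemma csubspace_image:
  assumes S: "bounded_clinear S" and M: "cvec.subspace M"
  shows "cvec.subspace (S ` M)"
proof (rule cvec.subspaceI)
  show "0 \<in> S ` M" using bounded_clinearD(5)[OF S] cvec.subspace_0[OF M] by force
  show "x + y \<in> S ` M" if "x \<in> S ` M" "y \<in> S ` M" for x y
    using that cvec.subspace_add[OF M] bounded_clinearD(3)[OF S] by (metis (no_types) image_iff)
  show "c *\<^sub>C x \<in> S ` M" if "x \<in> S ` M" for x c
    using that cvec.subspace_scale[OF M] bounded_clinearD(2)[OF S] by (metis (no_types) image_iff)
qed

lemma csubspace_kernel: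
  assumes S: "bounded_clinear S" and M: "cvec.subspace M"
  shows "cvec.subspace {x \<in> M. S x = 0}"
  using M by (intro cvec.subspaceI)
    (auto simp: bounded_clinearD[OF S] cvec.subspace_0 cvec.subspace_add cvec.subspace_scale)

lemma infdist_scaleC_le:
  assumes "cvec.subspace Y"
  shows "infdist (c *\<^sub>C x) Y \<le> cmod c * infdist x Y"
proof (cases "c = 0")
  case True
  then show ?thesis using cvec.subspace_0[OF assms] by simp
next
  case False
  have ne: "Y \<noteq> {}" using cvec.subspace_0[OF assms] by blast
  have "infdist (c *\<^sub>C x) Y / cmod c \<le> infdist x Y"
    unfolding infdist_notempty[OF ne, of x]
  proof (intro cINF_greatest ne)
    fix w assume "w \<in> Y"
    then have "infdist (c *\<^sub>C x) Y \<le> dist (c *\<^sub>C x) (c *\<^sub>C w)"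
      by (intro infdist_le cvec.subspace_scale assms)
    also have "\<dots> = cmod c * dist x w"
      by (simp add: dist_norm norm_scaleC flip: cvec.scale_right_diff_distrib)
    finally show "infdist (c *\<^sub>C x) Y / cmod c \<le> dist x w" using False by (simp add: field_simps)
  qed
  then show ?thesis using False by (simp add: field_simps)
qed

lemma kato_core:
  fixes S :: "'a::complex_banach \<Rightarrow> 'a"
  assumes S: "bounded_clinear S" and M: "closed M" "cvec.subspace M" "S ` M \<subseteq> M" and kato: "kato_on M S"
  obtains Y C where "closed Y" "cvec.subspace Y" "Y \<subseteq> M" "S ` Y = Y" "{x \<in> M. S x = 0} \<subseteq> Y"
    "C > 0" "lifting C S M (S ` M)"
proof -
  note bl = bounded_clinearD(1)[OF S]
  obtain C where C: "C > 0" "lifting C S M (S ` M)"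
    using open_mapping_lifting[OF bl M(1) subspace_if_csubspace[OF M(2)]] kato
    unfolding kato_on_def by blast
  define R where "R n = (S ^^ n) ` M" for n
  have R0: "R 0 = M" and RS: "R (Suc n) = S ` R n" for n
    by (simp_all add: R_def image_comp)
  have ker: "{x \<in> M. S x = 0} \<subseteq> R n" for n
    using kato unfolding kato_on_def R_def by blast
  have sub: "cvec.subspace (R n)" for n
    by (induction n) (simp_all add: R0 RS M csubspace_image[OF S])
  have RM: "R n \<subseteq> M" for n
    by (induction n) (use M(3) in \<open>auto simp: R0 RS\<close>)
  have cl: "closed (R n)" for n
  proof (induction n)
    case (Suc n)
    \<comment> \<open>The preimage obtained for \<open>M\<close> already lies in \<open>R n\<close>,
      so the constant does not deteriorate with \<open>n\<close>.\<close>
    have "lifting C S (R n) (S ` R n)"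
      unfolding lifting_def
    proof
      fix y assume "y \<in> S ` R n"
      then obtain z where z: "z \<in> R n" "y = S z" by blast
      then have "y \<in> S ` M" using RM by blast
      then obtain x where x: "x \<in> M" "S x = y" "norm x \<le> C * norm y"
        using C(2) unfolding lifting_def by blast
      have "x - z \<in> {x \<in> M. S x = 0}"
        using x z RM M(2) bounded_clinearD(4)[OF S] by (auto intro: cvec.subspace_diff)
      then have "(x - z) + z \<in> R n" using ker z sub by (intro cvec.subspace_add) auto
      then show "\<exists>x\<in>R n. S x = y \<and> norm x \<le> C * norm y" using x by auto
    qed
    then show ?case
      unfolding RS using C(1) closed_image_if_lifting[OF bl Suc subspace_if_csubspace[OF sub]] by simp
  qed (use M R0 in simp)
  define Y where "Y = (\<Inter>n. R n)"
  show ?thesis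
  proof
    show "closed Y" "cvec.subspace Y" "{x \<in> M. S x = 0} \<subseteq> Y"
      unfolding Y_def using cl sub ker by (auto intro: cvec.subspace_Inter)
    show YM: "Y \<subseteq> M" unfolding Y_def using R0 by blast
    show "S ` Y = Y"
    proof
      show "S ` Y \<subseteq> Y"
      proof
        fix y assume "y \<in> S ` Y"
        then obtain x where x: "x \<in> Y" "y = S x" by blast
        have "y \<in> R n" for n
        proof (cases n)
          case 0
          then show ?thesis using x YM M(3) R0 by blast
        next
          case (Suc m)
          then show ?thesis using x RS unfolding Y_def by blast
        qed
        then show "y \<in> Y" by (simp add: Y_def)
      qed
      show "Y \<subseteq> S ` Y"
      proof
        fix y assume y: "y \<in> Y"
        then have "\<exists>x\<in>R n. y = S x" for n using RS unfolding Y_def by blast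
        then obtain x where x: "\<And>n. x n \<in> R n" "\<And>n. y = S (x n)" by metis
        \<comment> \<open>A single preimage serves for all \<open>n\<close>, because it differs from
          \<open>x n\<close> by a kernel vector.\<close>
        have "x 0 \<in> R n" for n
        proof -
          have "x 0 - x n \<in> {x \<in> M. S x = 0}"
            using x(1) RM x(2)[of 0] x(2)[of n] M(2) bounded_clinearD(4)[OF S]
            by (auto intro: cvec.subspace_diff)
          then have "(x 0 - x n) + x n \<in> R n" using ker x sub by (intro cvec.subspace_add) auto
          then show ?thesis by simp
        qed
        then show "y \<in> S ` Y" using x(2) unfolding Y_def by blast
      qed
    qed
  qed (use C in auto)
qed

text \<open>
  Kato operators split as a surjective operator on \<open>Y\<close> and one that is bounded below modulo \<open>Y\<close>
  (with respect to the seminorm \<open>infdist x Y\<close>). Both properties survive small shifts with uniform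
  constants.
\<close>

lemma kato_shift:
  fixes S :: "'a::complex_banach \<Rightarrow> 'a"
  assumes S: "bounded_clinear S" and M: "cvec.subspace M" "S ` M \<subseteq> M"
    and Y: "closed Y" "cvec.subspace Y" "Y \<subseteq> M" "S ` Y = Y" "{x \<in> M. S x = 0} \<subseteq> Y"
    and C: "C > 0" "lifting C S M (S ` M)" and l: "2 * C * cmod l \<le> 1"
    and K: "\<And>x. norm (S x) \<le> K * norm x"
  shows "shift S l ` Y = Y" "{x \<in> M. shift S l x = 0} \<subseteq> Y"
    "lifting (8 * C + 6 * C * C * K) (shift S l) M (shift S l ` M)"
proof -
  let ?B = "shift S l"
  note rY = subspace_if_csubspace[OF Y(2)]
  have BY: "?B ` Y \<subseteq> Y"
    using Y(4) Y(2) by (auto simp: shift_def intro!: cvec.subspace_diff cvec.subspace_scale)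
  \<comment> \<open>The controlled preimage found in \<open>M\<close> lies in \<open>Y\<close>,
    since it differs from a preimage in \<open>Y\<close> by a kernel vector.\<close>
  have "lifting C S Y Y"
    unfolding lifting_def
  proof
    fix y assume "y \<in> Y"
    then obtain z where z: "z \<in> Y" "y = S z" using Y(4) by blast
    then obtain x where x: "x \<in> M" "S x = y" "norm x \<le> C * norm y"
      using C(2) Y(3) unfolding lifting_def by blast
    have "x - z \<in> {x \<in> M. S x = 0}"
      using x z Y(3) M(1) bounded_clinearD(4)[OF S] by (auto intro: cvec.subspace_diff)
    then have "(x - z) + z \<in> Y" using Y(2,5) z by (intro cvec.subspace_add) auto
    then show "\<exists>x\<in>Y. S x = y \<and> norm x \<le> C * norm y" using x by auto
  qed
  then have "lifting (2 * C) (\<lambda>x. S x + (- l) *\<^sub>C x) Y Y"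
  proof (rule lifting_perturb[OF bounded_clinearD(1)[OF S] bounded_linear_scaleC_right Y(1) rY rY _ _ _ C(1)])
    show "2 * C * norm ((- l) *\<^sub>C x) \<le> norm x" for x
      using mult_right_mono[OF l, of "norm x"] by (simp add: norm_scaleC mult.assoc)
    show "(\<lambda>x. (- l) *\<^sub>C x) ` Y \<subseteq> Y"
      by (intro image_subsetI cvec.subspace_scale Y)
  qed
  then have liftY: "lifting (2 * C) ?B Y Y" by (simp add: shift_def)
  have "y \<in> ?B ` Y" if "y \<in> Y" for y
    using liftY that unfolding lifting_def by (metis image_eqI)
  then show "?B ` Y = Y" using BY by blast
  have ne: "Y \<noteq> {}" using cvec.subspace_0[OF Y(2)] by blast
  \<comment> \<open>Every \<open>y\<close> in \<open>Y\<close> is some \<open>S u\<close> with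
    \<open>u\<close> in \<open>Y\<close>. A controlled preimage \<open>v\<close> of
    \<open>S (x - u)\<close> differs from \<open>x - u\<close> by a kernel vector, so
    \<open>x - v\<close> is in \<open>Y\<close> and \<open>norm v\<close> bounds the distance of
    \<open>x\<close> from \<open>Y\<close>.\<close>
  have dS: "infdist x Y \<le> C * infdist (S x) Y" if x: "x \<in> M" for x
  proof -
    have "infdist x Y / C \<le> infdist (S x) Y"
      unfolding infdist_notempty[OF ne, of "S x"]
    proof (intro cINF_greatest ne)
      fix y assume "y \<in> Y"
      then obtain u where u: "u \<in> Y" "y = S u" using Y(4) by blast
      have "S (x - u) \<in> S ` M" using x u Y(3) M(1) by (auto intro: cvec.subspace_diff)
      then obtain v where v: "v \<in> M" "S v = S (x - u)" "norm v \<le> C * norm (S (x - u))"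
        using C(2) unfolding lifting_def by blast
      have "x - u - v \<in> {x \<in> M. S x = 0}"
        using x u v Y(3) M(1) by (auto simp: bounded_clinearD(4)[OF S] intro!: cvec.subspace_diff)
      then have "(x - u - v) + u \<in> Y" using Y(2,5) u by (intro cvec.subspace_add) auto
      then have "infdist x Y \<le> norm v"
        using infdist_le[of "x - v" Y x] by (simp add: dist_norm algebra_simps)
      also have "\<dots> \<le> C * dist (S x) y" using v u by (simp add: bounded_clinearD(4)[OF S] dist_norm)
      finally show "infdist x Y / C \<le> dist (S x) y" using C(1) by (simp add: field_simps)
    qed
    then show ?thesis using C(1) by (simp add: field_simps)
  qed
  \<comment> \<open>The shift adds at most \<open>cmod l * infdist x Y\<close>, and
    \<open>C * cmod l <= 1 / 2\<close> lets this term be absorbed on the left.\<close>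
  have dB: "infdist x Y \<le> 2 * C * norm (?B x)" if x: "x \<in> M" for x
  proof -
    have "infdist (S x) Y \<le> infdist (l *\<^sub>C x) Y + norm (?B x)"
      using infdist_triangle[of "S x" Y "l *\<^sub>C x"] by (simp add: dist_norm shift_def)
    also have "\<dots> \<le> cmod l * infdist x Y + norm (?B x)"
      using infdist_scaleC_le[OF Y(2)] by simp
    finally have "C * infdist (S x) Y \<le> C * (cmod l * infdist x Y + norm (?B x))"
      using C(1) by (intro mult_left_mono) auto
    then have "2 * infdist x Y \<le> (2 * C * cmod l) * infdist x Y + 2 * C * norm (?B x)"
      using dS[OF x] by (simp add: algebra_simps)
    moreover have "(2 * C * cmod l) * infdist x Y \<le> 1 * infdist x Y"
      using l infdist_nonneg by (intro mult_right_mono) auto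
    ultimately show ?thesis by linarith
  qed
  show "{x \<in> M. ?B x = 0} \<subseteq> Y"
  proof safe
    fix x assume "x \<in> M" "?B x = 0"
    then have "infdist x Y = 0" using dB[of x] infdist_nonneg[of x Y] by simp
    then show "x \<in> Y" using in_closed_iff_infdist_zero[OF Y(1) ne] by simp
  qed
  show "lifting (8 * C + 6 * C * C * K) ?B M (?B ` M)"
    unfolding lifting_def
  proof
    fix y assume "y \<in> ?B ` M"
    then obtain x where x: "x \<in> M" "y = ?B x" by blast
    have B: "bounded_clinear ?B" using bounded_clinear_shift[OF S] .
    show "\<exists>x\<in>M. ?B x = y \<and> norm x \<le> (8 * C + 6 * C * C * K) * norm y"
    proof (cases "y = 0")
      case True
      then show ?thesis using bounded_clinearD(5)[OF B] cvec.subspace_0[OF M(1)] by (intro bexI[of _ 0]) auto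
    next
      case False
      \<comment> \<open>The distance bound has factor 2, and 3 leaves room for an unattained
        infimum. With \<open>v\<close> in \<open>Y\<close> solving \<open>?B v = ?B u\<close>, the
        vector \<open>x - u + v\<close> is the controlled solution: \<open>x - u\<close> contributes
        \<open>3 * C\<close>, and \<open>v\<close> contributes
        \<open>2 * C + 6 * C * C * K + 3 * C\<close>, the last summand by
        \<open>2 * C * cmod l <= 1\<close>.\<close>
      have "\<exists>u\<in>Y. dist x u \<le> 3 * C * norm y"
      proof (rule ccontr)
        assume "\<not> ?thesis"
        then have "3 * C * norm y \<le> infdist x Y"
          unfolding infdist_notempty[OF ne] by (intro cINF_greatest ne) auto
        then have "C * norm y \<le> 0" using dB[OF x(1)] x(2) by (simp add: mult.assoc)
        then show False using C(1) False by (simp add: mult_le_0_iff)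
      qed
      then obtain u where u: "u \<in> Y" "norm (x - u) \<le> 3 * C * norm y" by (auto simp: dist_norm)
      have "?B u \<in> Y" using BY u by blast
      then obtain v where v: "v \<in> Y" "?B v = ?B u" "norm v \<le> 2 * C * norm (?B u)"
        using liftY unfolding lifting_def by blast
      have "?B u = y - ?B (x - u)" using x bounded_clinearD(4)[OF B] by simp
      then have "norm (?B u) \<le> norm y + norm (?B (x - u))"
        using norm_triangle_ineq4 by metis
      also have "norm (?B (x - u)) \<le> norm (S (x - u)) + cmod l * norm (x - u)"
        unfolding shift_def using norm_triangle_ineq4[of "S (x - u)" "l *\<^sub>C (x - u)"] by (simp add: norm_scaleC)
      also have "norm (S (x - u)) \<le> K * norm (x - u)" by (rule K)
      finally have 1: "2 * C * norm (?B u) \<le> 2 * C * (norm y + (K * norm (x - u) + cmod l * norm (x - u)))"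
        using C(1) by (intro mult_left_mono) auto
      have K0: "0 \<le> K" using K[of x] K[of y] False
        by (metis (no_types, opaque_lifting) mult_less_0_iff norm_ge_zero not_le order_less_le_trans zero_less_norm_iff)
      have 2: "2 * C * K * norm (x - u) \<le> 2 * C * K * (3 * C * norm y)"
        using K0 C(1) u(2) by (intro mult_left_mono) auto
      have 3: "2 * C * cmod l * norm (x - u) \<le> 1 * (3 * C * norm y)"
        using l u(2) by (intro mult_mono) auto
      have "norm v \<le> 2 * C * norm y + 2 * C * K * (3 * C * norm y) + 3 * C * norm y"
        using v(3) 1 2 3 by (simp add: algebra_simps)
      then have "norm (x - u + v) \<le> (8 * C + 6 * C * C * K) * norm y"
        using norm_triangle_ineq[of "x - u" v] u(2) by (simp add: algebra_simps)
      moreover have "x - u + v \<in> M" "?B (x - u + v) = y"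
        using x u v Y(3) M(1) bounded_clinearD(3,4)[OF B]
        by (auto intro!: cvec.subspace_add cvec.subspace_diff)
      ultimately show ?thesis by blast
    qed
  qed
qed

lemma shift_diff_shift: "shift S l x - shift S m x = (m - l) *\<^sub>C x"
  by (simp add: shift_def cvec.scale_left_diff_distrib)

text \<open>A kernel vector \<open>x\<close> of \<open>S - l\<close> satisfies
  \<open>(S - m) x = (l - m) x\<close>; subtracting a controlled solution \<open>u\<close> of
  \<open>(S - m) u = (S - m) x\<close> gives a nearby kernel vector of \<open>S - m\<close>. Ranges
  are compared in the same way by applying \<open>S - l\<close> to a controlled preimage under
  \<open>S - m\<close>.\<close>

lemma kato_disc:
  fixes S :: "'a::complex_banach \<Rightarrow> 'a"
  assumes S: "bounded_clinear S" and M: "closed M" "cvec.subspace M" "S ` M \<subseteq> M" and kato: "kato_on M S"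
  obtains r Y where "r > 0" "cvec.subspace Y" "Y \<subseteq> M"
    "\<And>l. cmod l < r \<Longrightarrow> shift S l ` Y = Y"
    "\<And>l. cmod l < r \<Longrightarrow> {x \<in> M. shift S l x = 0} \<subseteq> Y"
    "\<And>l. cmod l < r \<Longrightarrow> closed (shift S l ` M)"
    "\<And>l m. cmod l < r \<Longrightarrow> cmod m < r \<Longrightarrow>
      rcodim {0} {x \<in> M. shift S l x = 0} = rcodim {0} {x \<in> M. shift S m x = 0}"
    "\<And>l m. cmod l < r \<Longrightarrow> cmod m < r \<Longrightarrow> rcodim (shift S l ` M) M = rcodim (shift S m ` M) M"
proof -
  obtain Y C where Y: "closed Y" "cvec.subspace Y" "Y \<subseteq> M" "S ` Y = Y" "{x \<in> M. S x = 0} \<subseteq> Y"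
    and C: "C > 0" "lifting C S M (S ` M)"
    using kato_core[OF S M kato] .
  obtain K where K: "K > 0" "\<And>x. norm (S x) \<le> K * norm x"
    using bounded_linear.pos_bounded[OF bounded_clinearD(1)[OF S]] by (metis mult.commute)
  define r where "r = 1 / (2 * C)"
  define L where "L = 8 * C + 6 * C * C * K"
  have L: "L > 0" using C K by (auto simp: L_def intro!: add_pos_pos)
  have r: "2 * C * cmod l \<le> 1" if "cmod l < r" for l
    using that C(1) by (simp add: r_def field_simps)
  note ks = kato_shift[OF S M(2,3) Y C r K(2)]
  have lift: "lifting L (shift S l) M (shift S l ` M)" if "cmod l < r" for l
    unfolding L_def using ks(3)[OF that] .
  have B: "bounded_clinear (shift S l)" for l using bounded_clinear_shift[OF S] .
  have BM: "shift S l ` M \<subseteq> M" for l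
    using M(2,3) by (auto simp: shift_def intro!: cvec.subspace_diff cvec.subspace_scale)
  have cl: "closed (shift S l ` M)" if "cmod l < r" for l
    using closed_image_if_lifting[OF bounded_clinearD(1)[OF B] M(1) subspace_if_csubspace[OF M(2)] lift[OF that]] L
    by simp
  \<comment> \<open>For fixed \<open>k\<close> the implication holds between any two points closer
    than \<open>d\<close>. Used in both directions it makes the level locally constant, hence
    constant on the connected disc. No single step length would serve all \<open>k\<close> at
    once.\<close>
  have lc: "P l = P m" if l: "cmod l < r" "cmod m < r" and d: "d > 0"
    and P: "\<And>l m. cmod l < r \<Longrightarrow> cmod m < r \<Longrightarrow> dist l m < d \<Longrightarrow> P l \<Longrightarrow> P m" for P l m d
  proof (rule connected_local_const[of "ball 0 r"])
    show "\<forall>a\<in>ball 0 r. \<forall>\<^sub>F b in at a within ball 0 r. P a = P b"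
    proof
      fix a :: complex assume a: "a \<in> ball 0 r"
      have "\<forall>b\<in>ball 0 r. b \<noteq> a \<and> dist b a < d \<longrightarrow> P a = P b"
        using P a by (auto simp: dist_commute)
      then show "\<forall>\<^sub>F b in at a within ball 0 r. P a = P b"
        unfolding eventually_at using d by blast
    qed
  qed (use l in auto)
  have d: "1 / (5 ^ k * L) > 0" for k :: nat using L by simp
  have small: "5 ^ k * (L * dist l m) < 1" if "dist l m < 1 / (5 ^ k * L)" for k :: nat and l m :: complex
    using that L by (simp add: field_simps)
  show ?thesis
  proof
    show "r > 0" using C(1) by (simp add: r_def)
    show "rcodim {0} {x \<in> M. shift S l x = 0} = rcodim {0} {x \<in> M. shift S m x = 0}"
      if "cmod l < r" "cmod m < r" for l m
    proof (rule enat_le_eqI, unfold enat_le_rcodim_iff, rule lc[OF that d])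
      fix k l m assume l: "cmod l < r" and m: "cmod m < r" and lm: "dist l m < 1 / (5 ^ k * L)"
        and ge: "rcodim_ge k {0} {x \<in> M. shift S l x = 0}"
      show "rcodim_ge k {0} {x \<in> M. shift S m x = 0}"
      proof (rule rcodim_ge_gap_subspace[OF csubspace_kernel[OF B M(2)] _ small[OF lm] ge])
        fix x assume x: "x \<in> {x \<in> M. shift S l x = 0}"
        obtain u where u: "u \<in> M" "shift S m u = shift S m x" "norm u \<le> L * norm (shift S m x)"
          using lift[OF m] x unfolding lifting_def by blast
        have "norm (shift S m x) = dist l m * norm x"
          using x shift_diff_shift[of S m x l] by (simp add: norm_scaleC dist_norm)
        then have "norm (x - (x - u)) \<le> L * dist l m * norm x" using u(3) by simp
        moreover have "x - u \<in> {x \<in> M. shift S m x = 0}"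
          using x u M(2) by (auto simp: bounded_clinearD(4)[OF B] intro: cvec.subspace_diff)
        ultimately show "\<exists>u\<in>{x \<in> M. shift S m x = 0}. norm (x - u) \<le> L * dist l m * norm x" by blast
      qed
    qed
    show "rcodim (shift S l ` M) M = rcodim (shift S m ` M) M"
      if "cmod l < r" "cmod m < r" for l m
    proof (rule enat_le_eqI, unfold enat_le_rcodim_iff, rule lc[OF that d])
      fix k l m assume l: "cmod l < r" and m: "cmod m < r" and lm: "dist l m < 1 / (5 ^ k * L)"
        and ge: "rcodim_ge k (shift S l ` M) M"
      show "rcodim_ge k (shift S m ` M) M"
      proof (rule rcodim_ge_gap_quotient[OF cl[OF l] csubspace_image[OF B M(2)] M(2) BM _ small[OF lm] _ ge])
        fix y assume "y \<in> shift S m ` M"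
        then obtain x where x: "x \<in> M" "shift S m x = y" "norm x \<le> L * norm y"
          using lift[OF m] unfolding lifting_def by blast
        have "norm (y - shift S l x) = dist l m * norm x"
          using x shift_diff_shift[of S m x l] by (simp add: norm_scaleC dist_norm)
        also have "\<dots> \<le> dist l m * (L * norm y)" using x(3) by (intro mult_left_mono) auto
        finally show "\<exists>u\<in>shift S l ` M. norm (y - u) \<le> L * dist l m * norm y"
          using x(1) by (auto simp: mult_ac)
      qed (use L in simp)
    qed
  qed (use Y(2,3) ks(1,2) cl in blast)+
qed

section \<open>Quasinilpotent operators\<close>

lemma bounded_linear_funpow:
  fixes S :: "'a::real_normed_vector \<Rightarrow> 'a"
  assumes "bounded_linear S"
  shows "bounded_linear (S ^^ n)"
proof (induction n)
  case 0
  then show ?case by (simp add: bounded_linear_ident id_def)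
next
  case (Suc n)
  show ?case using bounded_linear_compose[OF assms Suc] by (simp add: o_def)
qed

text \<open>A single power with small norm replaces the whole limit in what follows.\<close>

lemma quasinilpotent_on_bound:
  assumes S: "bounded_clinear S" and N: "cvec.subspace N" and qn: "quasinilpotent_on N S" and d: "d > 0"
  obtains n where "n > 0" "\<And>x. x \<in> N \<Longrightarrow> norm ((S ^^ n) x) \<le> d ^ n * norm x"
proof -
  have "eventually (\<lambda>n. root n (onorm_on N (S ^^ n)) < d) sequentially"
    using qn d unfolding quasinilpotent_on_def by (rule order_tendstoD)
  \<comment> \<open>\<open>root 0\<close> is constantly 0, so at \<open>n = 0\<close> the inequality
    says nothing; positivity of \<open>n\<close> is requested separately.\<close>
  then obtain n where n: "n > 0" "root n (onorm_on N (S ^^ n)) < d"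
    using eventually_happens'[OF sequentially_bot eventually_conj[OF eventually_gt_at_top[of 0]]] by blast
  let ?P = "S ^^ n"
  interpret P: bounded_linear ?P using bounded_linear_funpow bounded_clinearD(1)[OF S] by blast
  obtain K where K: "K > 0" "\<And>x. norm (?P x) \<le> norm x * K" using P.pos_bounded by blast
  \<comment> \<open>Without boundedness the supremum in \<open>onorm_on\<close> need not be an upper
    bound.\<close>
  have "bdd_above ((\<lambda>x. norm (?P x)) ` {x \<in> N. norm x \<le> 1})"
  proof (rule bdd_aboveI2)
    fix x assume "x \<in> {x \<in> N. norm x \<le> 1}"
    then have "norm x * K \<le> 1 * K" using K(1) by (intro mult_right_mono) auto
    then show "norm (?P x) \<le> K" using K(2)[of x] by linarith
  qed
  then have unit: "norm (?P x) \<le> onorm_on N ?P" if "x \<in> N" "norm x \<le> 1" for x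
    unfolding onorm_on_def using that by (intro cSUP_upper) auto
  have "0 \<le> onorm_on N ?P" using unit[of 0] cvec.subspace_0[OF N] by (simp add: P.zero)
  then have "onorm_on N ?P = root n (onorm_on N ?P) ^ n" using n(1) by simp
  also have "\<dots> \<le> d ^ n"
    using n \<open>0 \<le> onorm_on N ?P\<close> by (intro power_mono) auto
  finally have le: "onorm_on N ?P \<le> d ^ n" .
  show ?thesis
  proof (rule that[OF n(1)])
    fix x assume x: "x \<in> N"
    show "norm (?P x) \<le> d ^ n * norm x"
    proof (cases "x = 0")
      case False
      have "norm (?P ((1 / norm x) *\<^sub>R x)) \<le> d ^ n"
        using unit[OF subspace_scale[OF subspace_if_csubspace[OF N] x], of "1 / norm x"] le False by simp
      then show ?thesis using False by (simp add: P.scaleR field_simps)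
    qed (simp add: P.zero)
  qed
qed

text \<open>The power \<open>n\<close> is chosen with norm at most \<open>(cmod l / 2) ^ n\<close>
  on \<open>N\<close>. An eigenvector for \<open>l\<close> would be stretched by
  \<open>cmod l ^ n\<close>, which gives injectivity; surjectivity is inherited from
  \<open>S ^^ n\<close> minus \<open>l ^ n\<close>.\<close>

lemma quasinilpotent_on_shift:
  fixes S :: "'a::complex_banach \<Rightarrow> 'a"
  assumes S: "bounded_clinear S" and N: "closed N" "cvec.subspace N" "S ` N \<subseteq> N"
    and qn: "quasinilpotent_on N S" and l: "l \<noteq> 0"
  shows "shift S l ` N = N" "{x \<in> N. shift S l x = 0} = {0}"
proof -
  have "cmod l / 2 > 0" using l by simp
  from quasinilpotent_on_bound[OF S N(2) qn this]
  obtain n where n: "n > 0" "\<And>x. x \<in> N \<Longrightarrow> norm ((S ^^ n) x) \<le> (cmod l / 2) ^ n * norm x" by blast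
  \<comment> \<open>With lifting constant \<open>1 / cmod l ^ n\<close>, this is exactly the
    smallness required by \<open>lifting_perturb\<close>.\<close>
  have half: "2 * (1/2::real) ^ n \<le> 1" using n(1) by (cases n) (auto simp: power_le_one)
  have SN: "(S ^^ j) ` N \<subseteq> N" for j
  proof (induction j)
    case (Suc j)
    then show ?case using N(3) by (auto simp: image_subset_iff)
  qed simp
  have BN: "shift S l ` N \<subseteq> N"
    using N(2,3) by (auto simp: shift_def intro!: cvec.subspace_diff cvec.subspace_scale)
  note rN = subspace_if_csubspace[OF N(2)]
  show "{x \<in> N. shift S l x = 0} = {0}"
  proof
    show "{x \<in> N. shift S l x = 0} \<subseteq> {0}"
    proof
      fix x assume x: "x \<in> {x \<in> N. shift S l x = 0}"
      then have Sx: "S x = l *\<^sub>C x" by (simp add: shift_def)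
      have "(S ^^ j) x = l ^ j *\<^sub>C x" for j
        by (induction j) (simp_all add: bounded_clinearD(2)[OF S] Sx scaleC_scaleC mult.commute)
      then have "cmod l ^ n * norm x \<le> (cmod l / 2) ^ n * norm x"
        using n(2)[of x] x by (simp add: norm_scaleC norm_power)
      then have "cmod l ^ n * norm x \<le> cmod l ^ n * ((1/2) ^ n * norm x)"
        by (simp add: power_divide)
      then have "norm x \<le> (1/2) ^ n * norm x" using l by simp
      moreover have "2 * ((1/2) ^ n * norm x) \<le> norm x"
        using mult_right_mono[OF half norm_ge_zero[of x]] by (simp only: mult.assoc mult_1_left)
      ultimately have "norm x \<le> 0" by linarith
      then show "x \<in> {0}" by simp
    qed
  qed (use cvec.subspace_0[OF N(2)] bounded_clinearD(5)[OF bounded_clinear_shift[OF S]] in auto)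
  \<comment> \<open>\<open>S\<^sup>j - l\<^sup>j\<close> is a multiple of \<open>S - l\<close>, and for \<open>j = n\<close> it is a small perturbation of \<open>- l\<^sup>n\<close>.\<close>
  have factor: "\<exists>z\<in>N. (S ^^ j) x - l ^ j *\<^sub>C x = shift S l z" if "x \<in> N" for x j
    using that
  proof (induction j arbitrary: x)
    case 0
    then show ?case using cvec.subspace_0[OF N(2)] by (intro bexI[of _ 0]) (auto simp: shift_def bounded_clinearD(5)[OF S])
  next
    case (Suc j)
    then obtain z where z: "z \<in> N" "(S ^^ j) (S x) - l ^ j *\<^sub>C S x = shift S l z"
      using N(3) by blast
    have "shift S l (z + l ^ j *\<^sub>C x) = shift S l z + l ^ j *\<^sub>C shift S l x"
      by (simp add: bounded_clinearD(2,3)[OF bounded_clinear_shift[OF S]])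
    also have "\<dots> = (S ^^ Suc j) x - l ^ Suc j *\<^sub>C x"
      unfolding z(2)[symmetric]
      by (simp add: shift_def funpow_Suc_right cvec.scale_right_diff_distrib scaleC_scaleC mult.commute del: funpow.simps)
    finally show ?case using z(1) Suc.prems N(2) by (metis cvec.subspace_add cvec.subspace_scale)
  qed
  let ?f = "\<lambda>x. (- (l ^ n)) *\<^sub>C x"
  have lift: "lifting (2 * (1 / cmod l ^ n)) (\<lambda>x. ?f x + (S ^^ n) x) N N"
  proof (rule lifting_perturb[OF bounded_linear_scaleC_right bounded_linear_funpow[OF bounded_clinearD(1)[OF S]] N(1) rN rN _ SN])
    show "lifting (1 / cmod l ^ n) ?f N N"
      unfolding lifting_def
    proof
      fix y assume "y \<in> N"
      then show "\<exists>x\<in>N. ?f x = y \<and> norm x \<le> 1 / cmod l ^ n * norm y"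
        using l N(2) by (intro bexI[of _ "(- 1 / l ^ n) *\<^sub>C y"])
          (auto simp: norm_scaleC norm_divide norm_power scaleC_scaleC intro: cvec.subspace_scale cvec.subspace_neg)
    qed
    fix x assume "x \<in> N"
    then have "2 * (1 / cmod l ^ n) * norm ((S ^^ n) x) \<le> 2 * (1 / cmod l ^ n) * ((cmod l / 2) ^ n * norm x)"
      using n(2) by (intro mult_left_mono) auto
    also have "\<dots> = (2 * (1/2) ^ n) * norm x" using l by (simp add: power_divide)
    also have "\<dots> \<le> norm x" using mult_right_mono[OF half, of "norm x"] by simp
    finally show "2 * (1 / cmod l ^ n) * norm ((S ^^ n) x) \<le> norm x" .
  qed (use l in auto)
  have "y \<in> shift S l ` N" if y: "y \<in> N" for y
  proof -
    obtain x where "x \<in> N" "(S ^^ n) x - l ^ n *\<^sub>C x = y"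
      using bspec[OF lift[unfolded lifting_def] y] by auto
    then show ?thesis using factor[of x n] by force
  qed
  then show "shift S l ` N = N" using BN by blast
qed

lemma finite_rcodim_lifting:
  fixes S :: "'a::complex_banach \<Rightarrow> 'a"
  assumes S: "bounded_clinear S" and N: "closed N" "cvec.subspace N" "S ` N \<subseteq> N"
    and fin: "\<not> rcodim_ge (Suc n) (S ` N) N"
  obtains F C where "finite F" "F \<subseteq> N" "card F \<le> n" "C > 0" "closed (S ` N)"
    "lifting C (\<lambda>p. S (fst p) + snd p) (N \<times> cvec.span F) N" "closed (cvec.span F)"
proof -
  obtain F where F: "finite F" "F \<subseteq> N" "card F \<le> n" "S ` N \<inter> cvec.span F \<subseteq> {0}"
    "\<And>v. v \<in> N \<Longrightarrow> \<exists>s\<in>cvec.span F. v - s \<in> S ` N"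
    using finite_rcodim_span[OF csubspace_image[OF S N(2)] fin] by blast
  let ?E = "cvec.span F" and ?f = "\<lambda>p. S (fst p) + snd p"
  have EN: "?E \<subseteq> N" using cvec.span_minimal F(2) N(2) by blast
  have cE: "closed ?E"
    using closed_add_span[of "{0}", OF _ cvec.subspace_single_0 F(1)] by simp
  have im: "?f ` (N \<times> ?E) = N"
  proof
    show "?f ` (N \<times> ?E) \<subseteq> N" using N(2,3) EN by (auto intro!: cvec.subspace_add)
    show "N \<subseteq> ?f ` (N \<times> ?E)"
    proof
      fix v assume "v \<in> N"
      then obtain s x where "s \<in> ?E" "x \<in> N" "v - s = S x" using F(5) by blast
      then show "v \<in> ?f ` (N \<times> ?E)" by (intro image_eqI[of _ _ "(x, s)"]) (auto simp: algebra_simps)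
    qed
  qed
  have bf: "bounded_linear ?f"
    using bounded_linear_compose[OF bounded_clinearD(1)[OF S] bounded_linear_fst]
    by (intro bounded_linear_add bounded_linear_snd)
  obtain C where C: "C > 0" "lifting C ?f (N \<times> ?E) N"
    using open_mapping_lifting[OF bf, of "N \<times> ?E"] N cE im
      subspace_Times[OF subspace_if_csubspace[OF N(2)] subspace_if_csubspace[OF cvec.subspace_span[of F]]]
    by (auto intro: closed_Times)
  have "lifting C S N (S ` N)"
    unfolding lifting_def
  proof
    fix y assume "y \<in> S ` N"
    then obtain z where z: "z \<in> N" "y = S z" by blast
    then have "y \<in> N" using N(3) by blast
    then obtain p where p: "p \<in> N \<times> ?E" "S (fst p) + snd p = y" "norm p \<le> C * norm y"
      using C(2) unfolding lifting_def by blast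
    define x s where "x = fst p" and "s = snd p"
    have x: "x \<in> N" "s \<in> ?E" "S x + s = y" "norm (x, s) \<le> C * norm y"
      using p by (auto simp: x_def s_def)
    have "s = S (z - x)" using x z by (simp add: bounded_clinearD(4)[OF S] algebra_simps)
    then have "s \<in> S ` N \<inter> ?E" using x z N(2) by (auto intro: cvec.subspace_diff)
    then have "s = 0" using F(4) by blast
    then show "\<exists>x\<in>N. S x = y \<and> norm x \<le> C * norm y" using x order_trans[OF norm_fst_le[of x s] x(4)] by (intro bexI[of _ x]) auto
  qed
  then have "closed (S ` N)"
    using closed_image_if_lifting[OF bounded_clinearD(1)[OF S] N(1) subspace_if_csubspace[OF N(2)]] C(1) by simp
  then show ?thesis using that F C cE by blast
qed

text \<open>
  A quasinilpotent operator with finite nullity or defect has index \<open>0\<close>, because its small nonzero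
  shifts are bijective: solution spaces of a nonzero shift approximate the kernel.
\<close>

lemma quasinilpotent_rcodim_range_le:
  fixes S :: "'a::complex_banach \<Rightarrow> 'a"
  assumes S: "bounded_clinear S" and N: "closed N" "cvec.subspace N" "S ` N \<subseteq> N"
    and qn: "quasinilpotent_on N S" and cl: "closed (S ` N)"
  shows "rcodim (S ` N) N \<le> rcodim {0} {x \<in> N. S x = 0}"
proof -
  have "rcodim_ge k {0} {x \<in> N. S x = 0}" if ge: "rcodim_ge k (S ` N) N" for k
  proof -
    obtain C where C: "C > 0" "lifting C S N (S ` N)"
      using open_mapping_lifting[OF bounded_clinearD(1)[OF S] N(1) subspace_if_csubspace[OF N(2)] cl] .
    obtain e where e: "\<And>i. i < k \<Longrightarrow> e i \<in> N \<and> norm (e i) = 1"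
      "\<And>c w. w \<in> S ` N \<Longrightarrow> (\<Sum>i<k. cmod (c i)) \<le> 5 ^ k * norm (w + (\<Sum>i<k. c i *\<^sub>C e i))"
      using riesz_family[OF cl csubspace_image[OF S N(2)] N(2,3) ge] by blast
    \<comment> \<open>For \<open>v\<close> in the solution space,
      \<open>norm (S v) <= (1 + 5 ^ k) * cmod l * norm v\<close>, and lifting multiplies by
      \<open>C\<close>. The choice of \<open>l\<close> makes \<open>5 ^ k * D * cmod l\<close> equal
      to 1/2.\<close>
    define D where "D = C * (1 + 5 ^ k)"
    have D: "D > 0" using C(1) by (auto simp: D_def intro!: mult_pos_pos add_pos_pos)
    define l where "l = complex_of_real (1 / (2 * 5 ^ k * D))"
    have l: "l \<noteq> 0" "5 ^ k * (D * cmod l) < 1"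
      using D by (simp_all add: l_def norm_divide norm_mult norm_power)
    let ?B = "shift S l"
    have B: "bounded_clinear ?B" using bounded_clinear_shift[OF S] .
    have "\<forall>i\<in>{..<k}. \<exists>x\<in>N. ?B x = e i"
      using e(1) quasinilpotent_on_shift(1)[OF S N qn l(1)] by (metis imageE lessThan_iff)
    then obtain x where x: "\<And>i. i < k \<Longrightarrow> x i \<in> N \<and> ?B (x i) = e i" by (metis lessThan_iff)
    have Bs: "?B (\<Sum>i<k. c i *\<^sub>C x i) = (\<Sum>i<k. c i *\<^sub>C e i)" for c
    proof -
      interpret B: bounded_linear ?B using bounded_clinearD(1)[OF B] .
      show ?thesis using x by (simp add: B.sum bounded_clinearD(2)[OF B])
    qed
    let ?V = "cvec.span (x ` {..<k})"
    have "rcodim_ge k {0} ?V"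
      unfolding rcodim_ge_def
    proof (intro exI[of _ x] conjI allI impI)
      fix c i assume c: "(\<Sum>i<k. c i *\<^sub>C x i) \<in> {0}" and i: "i < k"
      then have "(\<Sum>i<k. c i *\<^sub>C e i) = 0" using Bs[of c] bounded_clinearD(5)[OF B] by simp
      then have "(\<Sum>i<k. cmod (c i)) \<le> 0"
        using e(2)[of 0 c] cvec.subspace_0[OF csubspace_image[OF S N(2)]] by simp
      moreover have "cmod (c i) \<le> (\<Sum>i<k. cmod (c i))"
        using i by (intro member_le_sum) auto
      ultimately have "cmod (c i) \<le> 0" by linarith
      then show "c i = 0" by simp
    qed (auto intro: cvec.span_base)
    then show ?thesis
    proof (rule rcodim_ge_gap_subspace[OF cvec.subspace_span _ l(2), rotated])
      fix v assume v: "v \<in> ?V"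
      then obtain c where c: "v = (\<Sum>i<k. c i *\<^sub>C x i)" using span_image_lessThan by blast
      have vN: "v \<in> N" using v x cvec.span_minimal[OF _ N(2), of "x ` {..<k}"] by blast
      have Bv: "?B v = (\<Sum>i<k. c i *\<^sub>C e i)" using Bs c by simp
      \<comment> \<open>The Riesz bound modulo the range is applied to \<open>- S v + ?B v\<close>,
        which is just \<open>- l *\<^sub>C v\<close>. Hence the coefficients of \<open>?B v\<close>,
        and with them \<open>S v\<close>, are small relative to \<open>v\<close>.\<close>
      have "- S v \<in> S ` N" using vN N(2) bounded_clinearD(6)[OF S] by (metis cvec.subspace_neg imageI)
      then have "(\<Sum>i<k. cmod (c i)) \<le> 5 ^ k * norm (- S v + ?B v)" unfolding Bv by (rule e(2))
      then have 1: "(\<Sum>i<k. cmod (c i)) \<le> 5 ^ k * (cmod l * norm v)" by (simp add: shift_def norm_scaleC)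
      have "norm (?B v) \<le> (\<Sum>i<k. cmod (c i))"
        unfolding Bv by (rule sum_norm_le) (use e(1) in \<open>simp add: norm_scaleC\<close>)
      then have "norm (S v) \<le> cmod l * norm v + 5 ^ k * (cmod l * norm v)"
        using 1 norm_triangle_ineq[of "?B v" "l *\<^sub>C v"] by (simp add: shift_def norm_scaleC)
      then have "C * norm (S v) \<le> C * (cmod l * norm v + 5 ^ k * (cmod l * norm v))"
        using C(1) by (intro mult_left_mono) auto
      also have "\<dots> = D * cmod l * norm v" by (simp add: D_def algebra_simps)
      finally have 2: "C * norm (S v) \<le> D * cmod l * norm v" .
      obtain u where u: "u \<in> N" "S u = S v" "norm u \<le> C * norm (S v)"
        using C(2) vN unfolding lifting_def by blast
      then have "v - u \<in> {x \<in> N. S x = 0}"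
        using vN N(2) by (auto simp: bounded_clinearD(4)[OF S] intro: cvec.subspace_diff)
      moreover have "norm (v - (v - u)) \<le> D * cmod l * norm v" using u(3) 2 by simp
      ultimately show "\<exists>u\<in>{x \<in> N. S x = 0}. norm (v - u) \<le> D * cmod l * norm v" by blast
    qed
  qed
  then have "enat k \<le> rcodim {0} {x \<in> N. S x = 0}" if "enat k \<le> rcodim (S ` N) N" for k
    using that by (simp add: enat_le_rcodim_iff)
  then show ?thesis by (rule enat_leI)
qed

lemma rcodim_ge_injective_image:
  assumes B: "bounded_clinear B" and U: "cvec.subspace U" "\<And>x. x \<in> U \<Longrightarrow> B x = 0 \<Longrightarrow> x = 0"
    and E: "B ` U \<subseteq> E" and ge: "rcodim_ge k {0} U"
  shows "rcodim_ge k {0} E"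
proof -
  obtain e where e: "\<And>i. i < k \<Longrightarrow> e i \<in> U"
    "\<And>c. (\<Sum>i<k. c i *\<^sub>C e i) \<in> {0} \<Longrightarrow> \<forall>i<k. c i = 0"
    using ge unfolding rcodim_ge_def by blast
  interpret B: bounded_linear B using bounded_clinearD(1)[OF B] .
  have "\<forall>i<k. c i = 0" if c: "(\<Sum>i<k. c i *\<^sub>C B (e i)) \<in> {0}" for c
  proof (rule e(2))
    have "B (\<Sum>i<k. c i *\<^sub>C e i) = 0" using c by (simp add: B.sum bounded_clinearD(2)[OF B])
    moreover have "(\<Sum>i<k. c i *\<^sub>C e i) \<in> U"
      using e(1) U(1) by (intro cvec.subspace_sum cvec.subspace_scale) auto
    ultimately show "(\<Sum>i<k. c i *\<^sub>C e i) \<in> {0}" using U(2) by blast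
  qed
  then show ?thesis unfolding rcodim_ge_def using e(1) E by (intro exI[of _ "B \<circ> e"]) auto
qed

text \<open>The preimage \<open>U\<close> of a complement \<open>E\<close> of the range under an
  injective \<open>S - l\<close> has dimension at most that of \<open>E\<close>. A kernel vector
  \<open>x\<close> of \<open>S\<close> is mapped by \<open>S - l\<close> to the small vector
  \<open>- l x\<close>; solving for this modulo \<open>E\<close> moves \<open>x\<close> only
  slightly and lands in \<open>U\<close>. So the kernel has dimension at most that of
  \<open>E\<close>.\<close>

lemma quasinilpotent_rcodim_kernel_le:
  fixes S :: "'a::complex_banach \<Rightarrow> 'a"
  assumes S: "bounded_clinear S" and N: "closed N" "cvec.subspace N" "S ` N \<subseteq> N"
    and qn: "quasinilpotent_on N S" and fin: "rcodim (S ` N) N = enat n"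
  shows "rcodim {0} {x \<in> N. S x = 0} \<le> enat n" "closed (S ` N)"
proof -
  have "\<not> rcodim_ge (Suc n) (S ` N) N" using fin by (simp flip: enat_le_rcodim_iff)
  then obtain F C where F: "finite F" "F \<subseteq> N" "card F \<le> n" "C > 0" "closed (S ` N)"
    "lifting C (\<lambda>p. S (fst p) + snd p) (N \<times> cvec.span F) N" "closed (cvec.span F)"
    using finite_rcodim_lifting[OF S N] by metis
  let ?E = "cvec.span F" and ?f = "\<lambda>p. S (fst p) + snd p"
  show "closed (S ` N)" by fact
  have bf: "bounded_linear ?f"
    using bounded_linear_compose[OF bounded_clinearD(1)[OF S] bounded_linear_fst]
    by (intro bounded_linear_add bounded_linear_snd)
  have sD: "subspace (N \<times> ?E)"
    using subspace_Times[OF subspace_if_csubspace[OF N(2)] subspace_if_csubspace[OF cvec.subspace_span[of F]]] .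
  have "k \<le> n" if ge: "rcodim_ge k {0} {x \<in> N. S x = 0}" for k
  proof -
    \<comment> \<open>Makes \<open>5 ^ k * (2 * C * cmod l)\<close> equal to 1/2, which meets both
      the gap condition and the smallness condition of \<open>lifting_perturb\<close>.\<close>
    define l where "l = complex_of_real (1 / (2 * 5 ^ k * (2 * C)))"
    have l: "l \<noteq> 0" "5 ^ k * (2 * C * cmod l) < 1"
      using F(4) by (simp_all add: l_def norm_divide norm_mult norm_power)
    have "1 * (2 * C * cmod l) \<le> 5 ^ k * (2 * C * cmod l)" using F(4) by (intro mult_right_mono) auto
    then have l1: "2 * C * cmod l \<le> 1" using l(2) by linarith
    let ?B = "shift S l"
    have B: "bounded_clinear ?B" using bounded_clinear_shift[OF S] .
    have lift2: "lifting (2 * C) (\<lambda>p. ?f p + (- l) *\<^sub>C fst p) (N \<times> ?E) N"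
    proof (rule lifting_perturb[OF bf _ _ sD subspace_if_csubspace[OF N(2)] F(6) _ _ F(4)])
      show "bounded_linear (\<lambda>p::'a \<times> 'a. (- l) *\<^sub>C fst p)"
        using bounded_linear_compose[OF bounded_linear_scaleC_right bounded_linear_fst] .
      show "(\<lambda>p. (- l) *\<^sub>C fst p) ` (N \<times> ?E) \<subseteq> N"
      proof
        fix y assume "y \<in> (\<lambda>p. (- l) *\<^sub>C fst p) ` (N \<times> ?E)"
        then obtain p where "p \<in> N \<times> ?E" "y = (- l) *\<^sub>C fst p" by blast
        then show "y \<in> N" using cvec.subspace_scale[OF N(2), of "fst p" "- l"] by auto
      qed
      show "2 * C * norm ((- l) *\<^sub>C fst p) \<le> norm p" for p :: "'a \<times> 'a"
      proof -
        have "2 * C * cmod l * norm (fst p) \<le> 1 * norm p"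
          using l1 norm_fst_le[of "fst p" "snd p"] by (intro mult_mono) auto
        then show ?thesis by (simp add: norm_scaleC mult.assoc)
      qed
    qed (use N F in \<open>auto intro: closed_Times\<close>)
    have lift: "\<exists>v\<in>N. \<exists>s\<in>?E. ?B v + s = y \<and> norm v \<le> 2 * C * norm y" if y: "y \<in> N" for y
    proof -
      obtain p where p: "p \<in> N \<times> ?E" "?f p + (- l) *\<^sub>C fst p = y" "norm p \<le> 2 * C * norm y"
        using bspec[OF lift2[unfolded lifting_def] y] by blast
      then show ?thesis
        using norm_fst_le[of "fst p" "snd p"]
        by (intro bexI[of _ "fst p"] bexI[of _ "snd p"]) (auto simp: shift_def algebra_simps)
    qed
    let ?U = "{x \<in> N. ?B x \<in> ?E}"
    have sU: "cvec.subspace ?U"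
      using N(2) cvec.subspace_span[of F] by (intro cvec.subspaceI)
        (auto simp: bounded_clinearD[OF B] cvec.subspace_0 cvec.subspace_add cvec.subspace_scale)
    have "rcodim_ge k {0} ?U"
    proof (rule rcodim_ge_gap_subspace[OF csubspace_kernel[OF S N(2)] _ l(2) ge])
      fix x assume x: "x \<in> {x \<in> N. S x = 0}"
      then have Bx: "?B x = - (l *\<^sub>C x)" by (simp add: shift_def)
      have "?B x \<in> N" unfolding Bx using x N(2) by (auto intro: cvec.subspace_neg cvec.subspace_scale)
      then obtain v s where v: "v \<in> N" "s \<in> ?E" "?B v + s = ?B x" "norm v \<le> 2 * C * norm (?B x)"
        using lift by blast
      have "?B (x - v) = s" using v(3) by (simp add: bounded_clinearD(4)[OF B] algebra_simps)
      then have "x - v \<in> ?U" using x v N(2) by (auto intro: cvec.subspace_diff)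
      moreover have "norm (x - (x - v)) \<le> 2 * C * cmod l * norm x"
        using v(4) unfolding Bx by (simp add: norm_scaleC mult.assoc)
      ultimately show "\<exists>u\<in>?U. norm (x - u) \<le> 2 * C * cmod l * norm x" by blast
    qed
    then have "rcodim_ge k {0} ?E"
    proof (rule rcodim_ge_injective_image[OF B sU, rotated 2])
      show "x = 0" if "x \<in> ?U" "?B x = 0" for x
        using quasinilpotent_on_shift(2)[OF S N qn l(1)] that by blast
    qed blast
    then have "k \<le> card F"
      by (intro rcodim_ge_le_card[OF cvec.subspace_single_0 F(1)]) auto
    then show ?thesis using F(3) by linarith
  qed
  then have "enat k \<le> enat n" if "enat k \<le> rcodim {0} {x \<in> N. S x = 0}" for k
    using that by (simp add: enat_le_rcodim_iff)
  then show "rcodim {0} {x \<in> N. S x = 0} \<le> enat n" by (rule enat_leI)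
qed

section \<open>Operator classes and direct decompositions\<close>

lemma alpha_eq_rcodim: "bounded_clinear S \<Longrightarrow> alpha S = rcodim {0} (ker S)"
  unfolding alpha_def ker_def
  using csubspace_kernel[of S UNIV] by (intro ecdim_eq_rcodim) simp

lemma beta_eq_rcodim: "bounded_clinear S \<Longrightarrow> beta S = rcodim (range S) UNIV"
  unfolding beta_def by (intro ecodim_eq_rcodim csubspace_image cvec.subspace_UNIV)

lemma alpha_eq_0_iff: "bounded_clinear S \<Longrightarrow> alpha S = 0 \<longleftrightarrow> ker S = {0}"
  by (auto simp: alpha_eq_rcodim rcodim_eq_0_iff[OF cvec.subspace_single_0] ker_def bounded_clinearD(5))

lemma beta_eq_0_iff: "bounded_clinear S \<Longrightarrow> beta S = 0 \<longleftrightarrow> surj S"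
  by (auto simp: beta_eq_rcodim rcodim_eq_0_iff[OF csubspace_image[OF _ cvec.subspace_UNIV]])

lemma bounded_below_ops_iff:
  fixes S :: "'a::complex_banach \<Rightarrow> 'a"
  assumes S: "bounded_clinear S"
  shows "S \<in> bounded_below_ops \<longleftrightarrow> ker S = {0} \<and> closed (range S)"
proof
  note bl = bounded_clinearD(1)[OF S]
  assume "S \<in> bounded_below_ops"
  then obtain c where c: "c > 0" "\<And>x. c * norm x \<le> norm (S x)" unfolding bounded_below_ops_def by blast
  have "lifting (1 / c) S UNIV (range S)"
    unfolding lifting_def using c by (auto simp: field_simps)
  then have "closed (range S)"
    using closed_image_if_lifting[OF bl closed_UNIV subspace_UNIV] c(1) by simp
  moreover have "ker S = {0}"
  proof -
    have "x = 0" if "S x = 0" for x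
    proof -
      have "c * norm x \<le> 0" using c(2)[of x] that by simp
      then show ?thesis using c(1) by (simp add: mult_le_0_iff)
    qed
    then show ?thesis using bounded_clinearD(5)[OF S] by (auto simp: ker_def)
  qed
  ultimately show "ker S = {0} \<and> closed (range S)" by blast
next
  note bl = bounded_clinearD(1)[OF S]
  assume inj: "ker S = {0} \<and> closed (range S)"
  then obtain C where C: "C > 0" "lifting C S UNIV (range S)"
    using open_mapping_lifting[OF bl closed_UNIV subspace_UNIV] by blast
  have "(1 / C) * norm x \<le> norm (S x)" for x
  proof -
    obtain u where u: "S u = S x" "norm u \<le> C * norm (S x)"
      using C(2) unfolding lifting_def by blast
    then have "u - x \<in> ker S" by (simp add: ker_def bounded_clinearD(4)[OF S])
    then have "u = x" using inj by simp
    then show ?thesis using u C(1) by (simp add: field_simps)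
  qed
  then show "S \<in> bounded_below_ops"
    unfolding bounded_below_ops_def using S C(1) by (auto intro!: exI[of _ "1 / C"])
qed

text \<open>Matches the definition of \<open>B_both\<close> as an intersection, so the invertible
  case follows from the bounded below and the surjective one.\<close>

lemma invertible_ops_eq: "(invertible_ops :: ('a::complex_banach \<Rightarrow> 'a) set) = bounded_below_ops \<inter> surjective_ops"
proof (intro equalityI subsetI)
  fix S :: "'a \<Rightarrow> 'a" assume "S \<in> invertible_ops"
  then obtain S' where S: "bounded_clinear S" "bounded_clinear S'" "S \<circ> S' = id" "S' \<circ> S = id"
    unfolding invertible_ops_def by blast
  have surj: "surj S" using S(3) by (metis comp_surj surj_def id_apply comp_apply)
  have "x = 0" if "S x = 0" for x
    using S(4) that bounded_clinearD(5)[OF S(2)] by (metis comp_apply id_apply)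
  then have "ker S = {0}" using bounded_clinearD(5)[OF S(1)] by (auto simp: ker_def)
  then show "S \<in> bounded_below_ops \<inter> surjective_ops"
    using bounded_below_ops_iff[OF S(1)] surj S(1) by (simp add: surjective_ops_def)
next
  fix S :: "'a \<Rightarrow> 'a" assume "S \<in> bounded_below_ops \<inter> surjective_ops"
  then obtain c where S: "bounded_clinear S" "surj S" "c > 0" "\<And>x. c * norm x \<le> norm (S x)"
    unfolding bounded_below_ops_def surjective_ops_def by blast
  have "ker S = {0}" using \<open>S \<in> _\<close> bounded_below_ops_iff[OF S(1)] by blast
  then have inj: "inj S"
    by (intro injI) (metis (mono_tags, lifting) S(1) bounded_clinearD(4) eq_iff_diff_eq_0 ker_def mem_Collect_eq singletonD)
  have SS: "S (inv S x) = x" for x using surj_f_inv_f[OF S(2)] .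
  have SS': "inv S (S x) = x" for x using inv_f_f[OF inj] .
  have "bounded_clinear (inv S)"
    unfolding bounded_clinear_def
  proof (intro conjI allI bounded_linear_intro[where K = "1 / c"])
    show "inv S (x + y) = inv S x + inv S y" for x y
      by (metis SS SS' bounded_clinearD(3)[OF S(1)])
    show C: "inv S (a *\<^sub>C x) = a *\<^sub>C inv S x" for a x
      by (metis SS SS' bounded_clinearD(2)[OF S(1)])
    show "inv S (r *\<^sub>R x) = r *\<^sub>R inv S x" for r x
      using C[of "complex_of_real r"] by (simp add: scaleC_of_real)
    show "norm (inv S x) \<le> norm x * (1 / c)" for x
      using S(4)[of "inv S x"] S(3) by (simp add: SS field_simps)
  qed
  then show "S \<in> invertible_ops"
    unfolding invertible_ops_def using S(1) SS SS' by (auto intro!: exI[of _ "inv S"])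
qed

lemma bounded_below_ops_subset_B_plus: "(bounded_below_ops :: ('a::complex_banach \<Rightarrow> 'a) set) \<subseteq> B_plus"
proof
  fix S :: "'a \<Rightarrow> 'a" assume S: "S \<in> bounded_below_ops"
  then have b: "bounded_clinear S" by (simp add: bounded_below_ops_def)
  then have k: "ker S = {0}" "closed (range S)" using S bounded_below_ops_iff by blast+
  have "ker (S ^^ 0) = ker (S ^^ Suc 0)" using k(1) by (simp add: ker_def)
  then have "enat 0 \<in> {enat n |n. ker (S ^^ n) = ker (S ^^ Suc n)}" by blast
  then have "asc S \<le> enat 0" unfolding asc_def by (rule Inf_lower)
  then have "asc S < \<infinity>" by (rule le_less_trans) simp
  then show "S \<in> B_plus"
    using alpha_eq_0_iff[OF b] k b by (simp add: B_plus_def Phi_plus_def zero_enat_def)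
qed

lemma surjective_ops_subset_B_minus: "(surjective_ops :: ('a::complex_banach \<Rightarrow> 'a) set) \<subseteq> B_minus"
proof
  fix S :: "'a \<Rightarrow> 'a" assume "S \<in> surjective_ops"
  then have b: "bounded_clinear S" "surj S" by (simp_all add: surjective_ops_def)
  have "range (S ^^ 0) = range (S ^^ Suc 0)" using b(2) by simp
  then have "enat 0 \<in> {enat n |n. range (S ^^ n) = range (S ^^ Suc n)}" by blast
  then have "dsc S \<le> enat 0" unfolding dsc_def by (rule Inf_lower)
  then have "dsc S < \<infinity>" by (rule le_less_trans) simp
  then show "S \<in> B_minus"
    using beta_eq_0_iff[OF b(1)] b by (simp add: B_minus_def Phi_minus_def zero_enat_def)
qed

text \<open>Since \<open>S\<close> maps \<open>Y\<close> onto itself, a kernel vector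
  \<open>x\<close> is \<open>(S ^^ n) y\<close>. Then \<open>y\<close> is killed by
  \<open>S ^^ Suc n\<close>, hence by \<open>S ^^ n\<close> once the kernels have stabilised, and
  \<open>x = 0\<close>.\<close>

lemma finite_asc_inj_on:
  assumes S: "asc S < \<infinity>" and Y: "S ` Y = Y" and x: "x \<in> Y" "S x = 0"
  shows "x = 0"
proof -
  have "{enat n |n. ker (S ^^ n) = ker (S ^^ Suc n)} \<noteq> {}"
    using S unfolding asc_def by (metis Inf_empty less_irrefl top_enat_def)
  then obtain n where n: "ker (S ^^ n) = ker (S ^^ Suc n)" by blast
  have "(S ^^ j) ` Y = Y" for j
  proof (induction j)
    case (Suc j)
    have "(S ^^ Suc j) ` Y = S ` (S ^^ j) ` Y" by (simp add: image_comp)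
    then show ?case using Suc Y by simp
  qed simp
  then obtain y where y: "x = (S ^^ n) y" using x(1) by blast
  then have "y \<in> ker (S ^^ Suc n)" using x(2) by (simp add: ker_def)
  then have "y \<in> ker (S ^^ n)" using n by blast
  then show ?thesis using y by (simp add: ker_def)
qed

text \<open>From \<open>(S ^^ n) y = (S ^^ Suc n) z\<close> pass to the \<open>M\<close> component
  \<open>m\<close> of \<open>z\<close>: then \<open>y - S m\<close> is killed by
  \<open>S ^^ n\<close>, so it lies in \<open>Y\<close>, where everything has a preimage.\<close>

lemma finite_dsc_surj_on:
  assumes S: "bounded_clinear S" "dsc S < \<infinity>" and MN: "direct_decomp M N" "S ` M \<subseteq> M" "S ` N \<subseteq> N"
    and Y: "Y \<subseteq> M" "S ` Y = Y" "{x \<in> M. S x = 0} \<subseteq> Y" "cvec.subspace Y"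
  shows "S ` M = M"
proof -
  have "{enat n |n. range (S ^^ n) = range (S ^^ Suc n)} \<noteq> {}"
    using S(2) unfolding dsc_def by (metis Inf_empty less_irrefl top_enat_def)
  then obtain n where n: "range (S ^^ n) = range (S ^^ Suc n)" by blast
  have M: "cvec.subspace M" "cvec.subspace N" "M \<inter> N = {0}" using MN(1) by (auto simp: direct_decomp_def)
  interpret P: bounded_linear "S ^^ j" for j
    using bounded_linear_funpow[OF bounded_clinearD(1)[OF S(1)]] .
  have pow: "(S ^^ j) x \<in> M" if "x \<in> M" for x j
    using that MN(2) by (induction j) auto
  have powN: "(S ^^ j) x \<in> N" if "x \<in> N" for x j
    using that MN(3) by (induction j) auto
  \<comment> \<open>Stated for vectors mapped into \<open>Y\<close> rather than to 0, so that the
    induction peels off one factor of \<open>S\<close> at a time.\<close>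
  have ker: "x \<in> Y" if "x \<in> M" "(S ^^ j) x \<in> Y" for x j
    using that
  proof (induction j)
    case (Suc j)
    then obtain y where y: "y \<in> Y" "S ((S ^^ j) x) = S y" using Y(2) by auto
    have "(S ^^ j) x - y \<in> {x \<in> M. S x = 0}"
      using y pow[OF Suc.prems(1)] Y(1) M(1) by (auto simp: bounded_clinearD(4)[OF S(1)] intro: cvec.subspace_diff)
    then have "((S ^^ j) x - y) + y \<in> Y" using Y(3,4) y(1) by (intro cvec.subspace_add) auto
    then show ?case using Suc by simp
  qed simp
  have "y \<in> S ` M" if y: "y \<in> M" for y
  proof -
    obtain z where z: "(S ^^ n) y = (S ^^ Suc n) z" using n by (metis rangeE rangeI)
    obtain m v where mv: "m \<in> M" "v \<in> N" "z = m + v" using MN(1) unfolding direct_decomp_def by blast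
    have "(S ^^ n) y - (S ^^ Suc n) m = (S ^^ Suc n) v" using z mv(3) P.add[of "Suc n" m v] by simp
    moreover have "(S ^^ n) y - (S ^^ Suc n) m \<in> M"
      using pow[OF y] pow[OF mv(1), of "Suc n"] M(1) by (intro cvec.subspace_diff)
    ultimately have "(S ^^ n) y - (S ^^ Suc n) m = 0"
      using powN[OF mv(2), of "Suc n"] M(3) by (metis IntI singletonD)
    then have "(S ^^ n) (y - S m) = 0"
      by (simp add: P.diff funpow_swap1)
    moreover have Sm: "S m \<in> M" using mv(1) MN(2) by blast
    ultimately have "y - S m \<in> Y"
      using ker[of "y - S m" n] y M(1) cvec.subspace_0[OF Y(4)] by (simp add: cvec.subspace_diff)
    then obtain u where u: "u \<in> Y" "y - S m = S u" using Y(2) by blast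
    then have "y = S (u + m)" by (simp add: bounded_clinearD(3)[OF S(1)] algebra_simps)
    then show ?thesis using u mv(1) Y(1) M(1) by (auto intro: cvec.subspace_add)
  qed
  then show ?thesis using MN(2) by blast
qed

section \<open>Nullity, defect and closed ranges along a direct decomposition\<close>

lemma alpha_direct_decomp:
  assumes S: "bounded_clinear S" and MN: "direct_decomp M N" "S ` M \<subseteq> M" "S ` N \<subseteq> N"
  shows "alpha S = rcodim {0} {x \<in> M. S x = 0} + rcodim {0} {x \<in> N. S x = 0}"
  unfolding alpha_eq_rcodim[OF S]
proof (rule rcodim_add)
  have M: "cvec.subspace M" "cvec.subspace N" "M \<inter> N = {0}" using MN(1) by (auto simp: direct_decomp_def)
  show "cvec.subspace {x \<in> M. S x = 0}" "cvec.subspace {x \<in> N. S x = 0}"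
    using csubspace_kernel[OF S] M by auto
  fix v assume v: "v \<in> ker S"
  obtain m n where mn: "m \<in> M" "n \<in> N" "v = m + n" using MN(1) unfolding direct_decomp_def by blast
  then have "S m = - S n" using v by (simp add: ker_def bounded_clinearD(3)[OF S] eq_neg_iff_add_eq_0)
  moreover have "- S n \<in> N" using MN(3) mn(2) M(2) by (auto intro: cvec.subspace_neg)
  ultimately have "S m \<in> M \<inter> N" using MN(2) mn(1) by auto
  then have "S m = 0" "S n = 0" using M(3) \<open>S m = - S n\<close> by auto
  then show "\<exists>v1\<in>{x \<in> M. S x = 0}. \<exists>v2\<in>{x \<in> N. S x = 0}. v = v1 + v2" using mn by blast
next
  fix x y assume xy: "x \<in> {x \<in> M. S x = 0}" "y \<in> {x \<in> N. S x = 0}" "x + y \<in> {0}"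
  then have "x = - y" "- y \<in> N" using MN(1) by (simp_all add: eq_neg_iff_add_eq_0 direct_decomp_def cvec.subspace_neg)
  then have "x \<in> M" "x \<in> N" using xy MN(1) by (simp_all add: direct_decomp_def cvec.subspace_neg)
  then have "x = 0" using MN(1) unfolding direct_decomp_def by blast
  then show "x \<in> {0} \<and> y \<in> {0}" using xy(3) by simp
qed (auto simp: ker_def intro: cvec.subspace_single_0)

text \<open>With \<open>x + y = S (m + n)\<close>, the vector \<open>x - S m = S n - y\<close> lies
  in both summands and therefore vanishes.\<close>

lemma direct_decomp_image_split:
  assumes S: "bounded_clinear S" and MN: "direct_decomp M N" "S ` M \<subseteq> M" "S ` N \<subseteq> N"
    and xy: "x \<in> M" "y \<in> N" "x + y \<in> range S"
  shows "x \<in> S ` M \<and> y \<in> S ` N"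
proof -
  have M: "cvec.subspace M" "cvec.subspace N" "M \<inter> N = {0}" using MN(1) by (auto simp: direct_decomp_def)
  obtain z where z: "x + y = S z" using xy(3) by blast
  obtain m n where mn: "m \<in> M" "n \<in> N" "z = m + n" using MN(1) unfolding direct_decomp_def by blast
  have eq: "x - S m = S n - y" using z mn(3) by (simp add: bounded_clinearD(3)[OF S] algebra_simps)
  have "x - S m \<in> M" using xy(1) mn(1) MN(2) M(1) by (auto intro: cvec.subspace_diff)
  moreover have "S n - y \<in> N" using xy(2) mn(2) MN(3) M(2) by (auto intro: cvec.subspace_diff)
  ultimately have "x - S m \<in> M \<inter> N" using eq by auto
  then have "x - S m = 0" using M(3) by blast
  then have "x = S m" "y = S n" using eq by auto
  then show ?thesis using mn by blast
qed

lemma beta_direct_decomp: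
  assumes S: "bounded_clinear S" and MN: "direct_decomp M N" "S ` M \<subseteq> M" "S ` N \<subseteq> N"
  shows "beta S = rcodim (S ` M) M + rcodim (S ` N) N"
  unfolding beta_eq_rcodim[OF S]
proof (rule rcodim_add)
  show "cvec.subspace M" "cvec.subspace N" using MN(1) by (auto simp: direct_decomp_def)
  then show "cvec.subspace (range S)" "cvec.subspace (S ` M)" "cvec.subspace (S ` N)"
    using csubspace_image[OF S] cvec.subspace_UNIV by auto
  show "\<exists>v1\<in>M. \<exists>v2\<in>N. v = v1 + v2" for v using MN(1) unfolding direct_decomp_def by blast
qed (use direct_decomp_image_split[OF assms] in auto)

text \<open>The sum map from the product of \<open>M\<close> and \<open>N\<close> is open, and
  components are unique. Its controlled preimage of a vector of \<open>W + N\<close> thus already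
  has first component in \<open>W\<close>, and the lifting restricts with the same constant.\<close>

lemma closed_sum_subsets:
  fixes M N :: "'a::complex_banach set"
  assumes MN: "direct_decomp M N" "closed M" "closed N"
    and W: "closed W" "cvec.subspace W" "W \<subseteq> M"
  shows "closed {w + n |w n. w \<in> W \<and> n \<in> N}"
proof -
  let ?f = "\<lambda>p::'a \<times> 'a. fst p + snd p"
  have M: "cvec.subspace M" "cvec.subspace N" "M \<inter> N = {0}" using MN(1) by (auto simp: direct_decomp_def)
  have bf: "bounded_linear ?f" by (intro bounded_linear_add bounded_linear_fst bounded_linear_snd)
  have im: "?f ` (M \<times> N) = UNIV" using MN(1) unfolding direct_decomp_def by force
  obtain C where C: "C > 0" "lifting C ?f (M \<times> N) UNIV"
    using open_mapping_lifting[OF bf closed_Times[OF MN(2,3)]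
      subspace_Times[OF subspace_if_csubspace[OF M(1)] subspace_if_csubspace[OF M(2)]]] im by auto
  have "lifting C ?f (W \<times> N) (?f ` (W \<times> N))"
    unfolding lifting_def
  proof
    fix y assume "y \<in> ?f ` (W \<times> N)"
    then obtain w n where wn: "w \<in> W" "n \<in> N" "y = w + n" by auto
    obtain p where p: "p \<in> M \<times> N" "fst p + snd p = y" "norm p \<le> C * norm y"
      using C(2) unfolding lifting_def by blast
    have eq: "fst p - w = n - snd p" using p(2) wn(3) by (simp add: algebra_simps)
    have "fst p - w \<in> M" using p(1) wn(1) W(3) M(1) by (auto intro: cvec.subspace_diff)
    moreover have "n - snd p \<in> N" using p(1) wn(2) M(2) by (auto intro: cvec.subspace_diff)
    ultimately have "fst p - w \<in> M \<inter> N" using eq by auto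
    then have "fst p = w" using M(3) by auto
    then have "p \<in> W \<times> N" using p(1) wn(1) by (cases p) auto
    then show "\<exists>x\<in>W \<times> N. ?f x = y \<and> norm x \<le> C * norm y" using p by blast
  qed
  then have "closed (?f ` (W \<times> N))"
    using C(1) closed_image_if_lifting[OF bf closed_Times[OF W(1) MN(3)]
      subspace_Times[OF subspace_if_csubspace[OF W(2)] subspace_if_csubspace[OF M(2)]]] by simp
  moreover have "?f ` (W \<times> N) = {w + n |w n. w \<in> W \<and> n \<in> N}" by force
  ultimately show ?thesis by simp
qed

section \<open>The punctured disc\<close>

lemma quasinilpotent_rcodim_eq:
  fixes S :: "'a::complex_banach \<Rightarrow> 'a"
  assumes S: "bounded_clinear S" and N: "closed N" "cvec.subspace N" "S ` N \<subseteq> N"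
    and qn: "quasinilpotent_on N S" and fin: "rcodim (S ` N) N < \<infinity>"
  shows "rcodim (S ` N) N = rcodim {0} {x \<in> N. S x = 0}"
proof -
  obtain n where n: "rcodim (S ` N) N = enat n" using fin by auto
  show ?thesis
    using quasinilpotent_rcodim_kernel_le[OF S N qn n] quasinilpotent_rcodim_range_le[OF S N qn] n by simp
qed

text \<open>A difference of extended values reflects the order of its terms when the subtraction is
  not infinity minus infinity. Each Weyl class supplies a finite term, so the sign of
  \<open>ind\<close> becomes a comparison in \<open>enat\<close>.\<close>

lemma W_plus_iff: "S \<in> W_plus \<longleftrightarrow> S \<in> Phi_plus \<and> alpha S \<le> beta S"
proof -
  have "ind S \<le> 0 \<longleftrightarrow> alpha S \<le> beta S" if "alpha S < \<infinity>"
    using that unfolding ind_def by (cases "alpha S"; cases "beta S") auto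
  then show ?thesis by (auto simp: W_plus_def Phi_plus_def)
qed

lemma W_minus_iff: "S \<in> W_minus \<longleftrightarrow> S \<in> Phi_minus \<and> beta S \<le> alpha S"
proof -
  have "ind S \<ge> 0 \<longleftrightarrow> beta S \<le> alpha S" if "beta S < \<infinity>"
    using that unfolding ind_def by (cases "alpha S"; cases "beta S") auto
  then show ?thesis by (auto simp: W_minus_def Phi_minus_def)
qed

lemma W_zero_iff: "S \<in> W_zero \<longleftrightarrow> S \<in> Phi \<and> alpha S = beta S"
proof -
  have "ind S = 0 \<longleftrightarrow> alpha S = beta S" if "alpha S < \<infinity>" "beta S < \<infinity>"
    using that unfolding ind_def by (cases "alpha S"; cases "beta S") (auto simp: zero_ereal_def)
  then show ?thesis by (auto simp: W_zero_def Phi_def)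
qed

text \<open>Cancels the contributions of the quasinilpotent part from an index inequality.\<close>

lemma enat_le_if_add_le_add: "b \<noteq> \<infinity> \<Longrightarrow> q \<noteq> \<infinity> \<Longrightarrow> a + p \<le> b + q \<Longrightarrow> q \<le> p \<Longrightarrow> a \<le> (b::enat)"
  by (cases a; cases b; cases p; cases q) auto

lemma enat_add_less_infinity_iff: "a + b < \<infinity> \<longleftrightarrow> a < \<infinity> \<and> b < (\<infinity>::enat)"
  by (cases a; cases b) auto

text \<open>The source point \<open>m\<close> may be the centre, the target \<open>l\<close> may
  not: only away from the centre does the quasinilpotent part contribute nothing.\<close>

lemma GKD_punctured_disc:
  fixes S :: "'a::complex_banach \<Rightarrow> 'a"
  assumes S: "bounded_clinear S" and "admits_GKD S"
  obtains r where "r > 0"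
    "\<And>m l. cmod m < r \<Longrightarrow> cmod l < r \<Longrightarrow> l \<noteq> 0 \<Longrightarrow>
      (\<forall>R\<in>{Phi_plus, Phi_minus, Phi, W_plus, W_minus, W_zero}. shift S m \<in> R \<longrightarrow> shift S l \<in> R) \<and>
      (shift S m \<in> B_plus \<longrightarrow> shift S l \<in> bounded_below_ops) \<and>
      (shift S m \<in> B_minus \<longrightarrow> shift S l \<in> surjective_ops)"
proof -
  obtain M N where MN: "direct_decomp M N" "closed M" "closed N" "S ` M \<subseteq> M" "S ` N \<subseteq> N"
    and kato: "kato_on M S" and qn: "quasinilpotent_on N S"
    using assms(2) unfolding admits_GKD_def by blast
  have M: "cvec.subspace M" and N: "cvec.subspace N" and int: "M \<inter> N = {0}"
    using MN(1) by (auto simp: direct_decomp_def)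
  obtain r Y where r: "r > 0" and Y: "cvec.subspace Y" "Y \<subseteq> M"
    "\<And>l. cmod l < r \<Longrightarrow> shift S l ` Y = Y"
    "\<And>l. cmod l < r \<Longrightarrow> {x \<in> M. shift S l x = 0} \<subseteq> Y"
    and cl: "\<And>l. cmod l < r \<Longrightarrow> closed (shift S l ` M)"
    and const: "\<And>l m. cmod l < r \<Longrightarrow> cmod m < r \<Longrightarrow>
      rcodim {0} {x \<in> M. shift S l x = 0} = rcodim {0} {x \<in> M. shift S m x = 0}"
    "\<And>l m. cmod l < r \<Longrightarrow> cmod m < r \<Longrightarrow> rcodim (shift S l ` M) M = rcodim (shift S m ` M) M"
    using kato_disc[OF S MN(2) M MN(4) kato] by blast
  have B: "bounded_clinear (shift S l)" for l using bounded_clinear_shift[OF S] .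
  have BM: "shift S l ` M \<subseteq> M" for l
    using MN(4) M by (auto simp: shift_def intro!: cvec.subspace_diff cvec.subspace_scale)
  have BN: "shift S l ` N \<subseteq> N" for l
    using MN(5) N by (auto simp: shift_def intro!: cvec.subspace_diff cvec.subspace_scale)
  define a where "a = rcodim {0} {x \<in> M. shift S 0 x = 0}"
  define b where "b = rcodim (shift S 0 ` M) M"
  \<comment> \<open>\<open>p\<close> and \<open>q\<close> are the nullity and defect of the
    \<open>N\<close> part; they vanish off the centre and may be positive, even infinite, at
    it.\<close>
  define p where "p l = rcodim {0} {x \<in> N. shift S l x = 0}" for l
  define q where "q l = rcodim (shift S l ` N) N" for l
  have al: "alpha (shift S l) = a + p l" if "cmod l < r" for l
    unfolding alpha_direct_decomp[OF B MN(1) BM BN] a_def p_def using const(1)[of l 0] that r by simp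
  have be: "beta (shift S l) = b + q l" if "cmod l < r" for l
    unfolding beta_direct_decomp[OF B MN(1) BM BN] b_def q_def using const(2)[of l 0] that r by simp
  have pq0: "p l = 0" "q l = 0" if "l \<noteq> 0" for l
    using quasinilpotent_on_shift[OF S MN(3) N MN(5) qn that]
    by (simp_all add: p_def q_def rcodim_eq_0_iff[OF cvec.subspace_single_0] rcodim_eq_0_iff[OF N])
  have pq: "p l = q l" if "q l < \<infinity>" for l
  proof (cases "l = 0")
    case True
    then show ?thesis using quasinilpotent_rcodim_eq[OF S MN(3) N MN(5) qn] that by (simp add: p_def q_def)
  qed (simp add: pq0)
  have qp: "q l \<le> p l" if cr: "closed (range (shift S l))" for l
  proof (cases "l = 0")
    case True
    \<comment> \<open>Invariance of both summands recovers the range on \<open>N\<close> by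
      intersection, so closedness passes from the whole range to it.\<close>
    have "S ` N = range S \<inter> N"
    proof
      show "range S \<inter> N \<subseteq> S ` N"
        using direct_decomp_image_split[OF S MN(1,4,5), of 0] cvec.subspace_0[OF M] by auto
    qed (use MN(5) in auto)
    then have "closed (S ` N)" using cr True MN(3) by (simp add: closed_Int)
    then show ?thesis
      using quasinilpotent_rcodim_range_le[OF S MN(3) N MN(5) qn] True by (simp add: p_def q_def)
  qed (simp add: pq0)
  \<comment> \<open>Off the centre all of \<open>N\<close> belongs to the range, which is thus a
    closed subspace of \<open>M\<close> plus \<open>N\<close>.\<close>
  have cr: "closed (range (shift S l))" if l: "cmod l < r" "l \<noteq> 0" for l
  proof -
    have "range (shift S l) = {w + n |w n. w \<in> shift S l ` M \<and> n \<in> N}"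
    proof safe
      fix x
      obtain m n where mn: "m \<in> M" "n \<in> N" "x = m + n" using MN(1) unfolding direct_decomp_def by blast
      then show "\<exists>w n. shift S l x = w + n \<and> w \<in> shift S l ` M \<and> n \<in> N"
        using BN by (intro exI[of _ "shift S l m"] exI[of _ "shift S l n"]) (auto simp: bounded_clinearD(3)[OF B])
    next
      fix m n assume mn: "m \<in> M" "n \<in> N"
      then obtain n' where "n = shift S l n'" using quasinilpotent_on_shift(1)[OF S MN(3) N MN(5) qn l(2)] by blast
      then show "shift S l m + n \<in> range (shift S l)"
        by (intro range_eqI[of _ _ "m + n'"]) (simp add: bounded_clinearD(3)[OF B])
    qed
    then show ?thesis using closed_sum_subsets[OF MN(1-3) cl[OF l(1)] csubspace_image[OF B M] BM] by simp
  qed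
  show ?thesis
  proof (rule that[OF r])
    fix m l :: complex assume m: "cmod m < r" and l: "cmod l < r" "l \<noteq> 0"
    note dims = al[OF m] be[OF m] al[OF l(1)] be[OF l(1)] pq0[OF l(2)]
    have Phi: "shift S l \<in> Phi_plus \<longleftrightarrow> a < \<infinity>" "shift S l \<in> Phi_minus \<longleftrightarrow> b < \<infinity>"
      "shift S l \<in> Phi \<longleftrightarrow> a < \<infinity> \<and> b < \<infinity>"
      using B cr[OF l] dims by (simp_all add: Phi_plus_def Phi_minus_def Phi_def)
    have W: "shift S l \<in> W_plus \<longleftrightarrow> a < \<infinity> \<and> a \<le> b" "shift S l \<in> W_minus \<longleftrightarrow> b < \<infinity> \<and> b \<le> a"
      "shift S l \<in> W_zero \<longleftrightarrow> a < \<infinity> \<and> b < \<infinity> \<and> a = b"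
      using dims by (auto simp: W_plus_iff W_minus_iff W_zero_iff Phi)
    have "shift S l \<in> Phi_plus" if "shift S m \<in> Phi_plus"
    proof -
      have "alpha (shift S m) < \<infinity>" using that by (simp_all only: Phi_plus_def mem_Collect_eq)
      then show ?thesis unfolding Phi dims(1,2) enat_add_less_infinity_iff by blast
    qed
    moreover have "shift S l \<in> Phi_minus" if "shift S m \<in> Phi_minus"
    proof -
      have "beta (shift S m) < \<infinity>" using that by (simp_all only: Phi_minus_def mem_Collect_eq)
      then show ?thesis unfolding Phi dims(1,2) enat_add_less_infinity_iff by blast
    qed
    moreover have "shift S l \<in> Phi" if "shift S m \<in> Phi"
    proof -
      have "alpha (shift S m) < \<infinity>" "beta (shift S m) < \<infinity>" using that by (simp_all only: Phi_def mem_Collect_eq)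
      then show ?thesis unfolding Phi dims(1,2) enat_add_less_infinity_iff by blast
    qed
    \<comment> \<open>Closedness of the range gives \<open>q m <= p m\<close>, and finiteness of
      \<open>p m\<close> then allows both to be cancelled.\<close>
    moreover have "shift S l \<in> W_plus" if "shift S m \<in> W_plus"
    proof -
      have fin: "a + p m < \<infinity>" and le: "a + p m \<le> b + q m" and qp: "q m \<le> p m"
        using that dims qp[of m] by (auto simp: W_plus_iff Phi_plus_def)
      have a: "a < \<infinity>" and "p m < \<infinity>" using fin unfolding enat_add_less_infinity_iff by blast+
      then have "q m \<noteq> \<infinity>" using qp by (cases "q m") auto
      then have "a \<le> b" using enat_le_if_add_le_add[OF _ _ le qp] by (cases "b = \<infinity>") auto
      with a show ?thesis unfolding W by blast
    qed
    \<comment> \<open>Here the defect is the finite quantity, and finiteness of \<open>q m\<close>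
      yields \<open>p m = q m\<close>.\<close>
    moreover have "shift S l \<in> W_minus" if "shift S m \<in> W_minus"
    proof -
      have fin: "b + q m < \<infinity>" and le: "b + q m \<le> a + p m"
        using that dims by (auto simp: W_minus_iff Phi_minus_def)
      have b: "b < \<infinity>" and q: "q m < \<infinity>" using fin unfolding enat_add_less_infinity_iff by blast+
      then have "p m \<noteq> \<infinity>" "p m \<le> q m" using pq[of m] by auto
      then have "b \<le> a" using enat_le_if_add_le_add[OF _ _ le] by (cases "a = \<infinity>") auto
      with b show ?thesis unfolding W by blast
    qed
    moreover have "shift S l \<in> W_zero" if "shift S m \<in> W_zero"
    proof -
      have fin: "b + q m < \<infinity>" "a + p m < \<infinity>" and eq: "a + p m = b + q m"
        using that dims by (auto simp: W_zero_iff Phi_def)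
      have "b < \<infinity>" "q m < \<infinity>" "a < \<infinity>" using fin unfolding enat_add_less_infinity_iff by blast+
      moreover from this have "a = b"
        using enat_le_if_add_le_add[of b "q m" a "p m"] enat_le_if_add_le_add[of a "p m" b "q m"]
          eq pq[of m] by auto
      ultimately show ?thesis unfolding W by blast
    qed
    moreover have "shift S l \<in> bounded_below_ops" if "shift S m \<in> B_plus"
    proof -
      \<comment> \<open>The kernel on \<open>M\<close> lies in \<open>Y\<close>, which the operator
        maps onto itself, so finite ascent makes it trivial. Constancy transfers this to every point
        of the disc.\<close>
      have "{x \<in> M. shift S m x = 0} \<subseteq> {0}"
        using finite_asc_inj_on[OF _ Y(3)[OF m]] Y(4)[OF m] that by (auto simp: B_plus_def)
      then have "a = 0"
        unfolding a_def using const(1)[of 0 m] m r by (simp add: rcodim_eq_0_iff[OF cvec.subspace_single_0])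
      then have "alpha (shift S l) = 0" using dims by simp
      then have "ker (shift S l) = {0}" unfolding alpha_eq_0_iff[OF B] .
      then show ?thesis unfolding bounded_below_ops_iff[OF B] using cr[OF l] by (rule conjI)
    qed
    moreover have "shift S l \<in> surjective_ops" if "shift S m \<in> B_minus"
    proof -
      have "dsc (shift S m) < \<infinity>" using that by (simp add: B_minus_def)
      then have "shift S m ` M = M"
        by (rule finite_dsc_surj_on[OF B _ MN(1) BM BN Y(2) Y(3)[OF m] Y(4)[OF m] Y(1)])
      then have "b = 0"
        unfolding b_def using const(2)[of 0 m] m r by (simp add: rcodim_eq_0_iff[OF M])
      then have "beta (shift S l) = 0" using dims by simp
      then show ?thesis using B unfolding beta_eq_0_iff[OF B] by (simp add: surjective_ops_def)
    qed
    ultimately show "(\<forall>R\<in>{Phi_plus, Phi_minus, Phi, W_plus, W_minus, W_zero}. shift S m \<in> R \<longrightarrow> shift S l \<in> R) \<and>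
      (shift S m \<in> B_plus \<longrightarrow> shift S l \<in> bounded_below_ops) \<and>
      (shift S m \<in> B_minus \<longrightarrow> shift S l \<in> surjective_ops)" by blast
  qed
qed

section \<open>From the punctured disc to the spectra\<close>

lemma frontier_Int_acc_subset_spec_gK:
  fixes T :: "'a::complex_banach \<Rightarrow> 'a"
  assumes T: "bounded_clinear T"
    and R: "\<And>S r. bounded_clinear S \<Longrightarrow> admits_GKD S \<Longrightarrow>
      \<exists>r>0. \<forall>m l. cmod m < r \<longrightarrow> cmod l < r \<longrightarrow> l \<noteq> 0 \<longrightarrow> shift S m \<in> R \<longrightarrow> shift S l \<in> R'"
  shows "frontier (spec R T) \<inter> acc (spec R' T) \<subseteq> spec_gK T"
proof
  fix z assume z: "z \<in> frontier (spec R T) \<inter> acc (spec R' T)"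
  show "z \<in> spec_gK T"
  proof (rule ccontr)
    assume "z \<notin> spec_gK T"
    then have "admits_GKD (shift T z)" by (simp add: spec_gK_def)
    then obtain r where r: "r > 0" "\<And>m l. cmod m < r \<Longrightarrow> cmod l < r \<Longrightarrow> l \<noteq> 0 \<Longrightarrow>
        shift T (z + m) \<in> R \<Longrightarrow> shift T (z + l) \<in> R'"
      using R[OF bounded_clinear_shift[OF T]] unfolding shift_shift by blast
    have "z \<in> closure (- spec R T)" using z by (simp add: frontier_closures)
    then obtain w where w: "w \<notin> spec R T" "dist w z < r"
      using r(1) unfolding closure_approachable by blast
    \<comment> \<open>An accumulation point supplies \<open>v\<close> different from
      \<open>z\<close>, matching the condition \<open>l ~= 0\<close>.\<close>
    obtain v where v: "v \<in> spec R' T" "v \<noteq> z" "dist v z < r"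
      using z r(1) unfolding acc_def islimpt_approachable by blast
    have "shift T (z + (v - z)) \<in> R'"
      by (rule r(2)[of "w - z"]) (use w v in \<open>auto simp: spec_def dist_norm\<close>)
    then show False using v(1) by (simp add: spec_def)
  qed
qed

theorem theorem4p5:
  fixes T :: "'a::complex_banach \<Rightarrow> 'a"
  assumes "ecdim (UNIV :: 'a set) = \<infinity>"
    and "bounded_clinear T"
  shows "(\<forall>i\<in>{1..12}. frontier (spec (R_class i) T) \<inter> acc (spec (R_class i) T) \<subseteq> spec_gK T) \<and>
    frontier (spec B_plus T) \<inter> acc (spec bounded_below_ops T) \<subseteq> spec_gK T \<and>
    frontier (spec B_minus T) \<inter> acc (spec surjective_ops T) \<subseteq> spec_gK T \<and>
    frontier (spec B_both T) \<inter> acc (spec invertible_ops T) \<subseteq> spec_gK T"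
proof -
  \<comment> \<open>Abstracts the analysis to two operators: \<open>S\<close> at an arbitrary point
    of the disc and \<open>S'\<close> at a point other than the centre. Each inclusion is then a
    set-theoretic consequence of the three transfer rules.\<close>
  have main: "frontier (spec R T) \<inter> acc (spec R' T) \<subseteq> spec_gK T"
    if sub: "\<And>S S' :: 'a \<Rightarrow> 'a.
        \<forall>R\<in>{Phi_plus, Phi_minus, Phi, W_plus, W_minus, W_zero}. S \<in> R \<longrightarrow> S' \<in> R \<Longrightarrow>
        S \<in> B_plus \<longrightarrow> S' \<in> bounded_below_ops \<Longrightarrow> S \<in> B_minus \<longrightarrow> S' \<in> surjective_ops \<Longrightarrow>
        S \<in> R \<Longrightarrow> S' \<in> R'" for R R' :: "('a \<Rightarrow> 'a) set"
  proof (rule frontier_Int_acc_subset_spec_gK[OF assms(2)])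
    fix S :: "'a \<Rightarrow> 'a" assume S: "bounded_clinear S" "admits_GKD S"
    from GKD_punctured_disc[OF S] obtain r where r: "r > 0"
      "\<And>m l. cmod m < r \<Longrightarrow> cmod l < r \<Longrightarrow> l \<noteq> 0 \<Longrightarrow>
      (\<forall>R\<in>{Phi_plus, Phi_minus, Phi, W_plus, W_minus, W_zero}. shift S m \<in> R \<longrightarrow> shift S l \<in> R) \<and>
      (shift S m \<in> B_plus \<longrightarrow> shift S l \<in> bounded_below_ops) \<and>
      (shift S m \<in> B_minus \<longrightarrow> shift S l \<in> surjective_ops)" by blast
    show "\<exists>r>0. \<forall>m l. cmod m < r \<longrightarrow> cmod l < r \<longrightarrow> l \<noteq> 0 \<longrightarrow> shift S m \<in> R \<longrightarrow> shift S l \<in> R'"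
    proof (intro exI[of _ r] conjI allI impI r(1))
      fix m l assume "cmod m < r" "cmod l < r" "l \<noteq> 0" "shift S m \<in> R"
      with r(2)[of m l] show "shift S l \<in> R'" by (intro sub[of "shift S m"]) simp_all
    qed
  qed
  note sub = bounded_below_ops_subset_B_plus[where 'a = 'a] surjective_ops_subset_B_minus[where 'a = 'a]
  have Phi: "frontier (spec R T) \<inter> acc (spec R T) \<subseteq> spec_gK T"
    if "R \<in> {Phi_plus, Phi_minus, Phi, W_plus, W_minus, W_zero}" for R
    by (rule main) (use that in blast)
  \<comment> \<open>Any source class inside \<open>B_plus\<close> may be paired with any target
    class containing \<open>bounded_below_ops\<close>. This covers the equal pairs of either class
    and the mixed pair together.\<close>
  have B: "frontier (spec R T) \<inter> acc (spec R' T) \<subseteq> spec_gK T"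
    if "R \<subseteq> B_plus" "bounded_below_ops \<subseteq> R'" for R R'
    by (rule main) (use that in blast)
  have B': "frontier (spec R T) \<inter> acc (spec R' T) \<subseteq> spec_gK T"
    if "R \<subseteq> B_minus" "surjective_ops \<subseteq> R'" for R R'
    by (rule main) (use that in blast)
  have B'': "frontier (spec R T) \<inter> acc (spec R' T) \<subseteq> spec_gK T"
    if "R \<subseteq> B_both" "invertible_ops \<subseteq> R'" for R R'
    by (rule main) (use that in \<open>unfold B_both_def invertible_ops_eq, blast\<close>)
  have inv: "(invertible_ops :: ('a \<Rightarrow> 'a) set) \<subseteq> B_both"
    unfolding invertible_ops_eq B_both_def using sub by blast
  have "frontier (spec (R_class i) T) \<inter> acc (spec (R_class i) T) \<subseteq> spec_gK T" if i: "i \<in> {1..12}" for i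
  proof -
    have "i = 1 \<or> i = 2 \<or> i = 3 \<or> i = 4 \<or> i = 5 \<or> i = 6 \<or> i = 7 \<or> i = 8 \<or> i = 9 \<or>
        i = 10 \<or> i = 11 \<or> i = 12"
      using i by (simp, presburger)
    then have "R_class i \<in> {Phi_plus, Phi_minus, Phi, W_plus, W_minus, W_zero} \<or>
        R_class i \<in> {B_plus, B_minus, B_both, bounded_below_ops, surjective_ops, invertible_ops :: ('a \<Rightarrow> 'a) set}"
      by (elim disjE) (simp_all add: R_class_def)
    then show ?thesis
    proof
      assume "R_class i \<in> {B_plus, B_minus, B_both, bounded_below_ops, surjective_ops, invertible_ops :: ('a \<Rightarrow> 'a) set}"
      then show ?thesis
        using sub inv by (elim insertE emptyE; simp only:) (rule B B' B''; simp)+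
    qed (rule Phi)
  qed
  with B[of B_plus bounded_below_ops] B'[of B_minus surjective_ops] B''[of B_both invertible_ops]
  show ?thesis by blast
qed

end
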